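(* There exists a $g\times g$ matrix $\mathbf{\Sigma}$ such that \[ \frac{H_1(\rho_X(t))}{\sqrt{t}}\xrightarrow{\ \mathcal{D}\ }\mathcal{N}(0,\mathbf{\Sigma})\qquad(t\to\infty), \] where $\mathcal{N}(0,\mathbf{\Sigma})$ is the centered multivariate normal distribution with covariance matrix $\mathbf{\Sigma}$.
   Context: Setting: - $G$ is a finite connected simple graph. - $(X_t)_{t\ge0}$ is a Markov chain on $V(G)$ with transition matrix $P$, where $P(x,y)=0$ unless $x=y$ or $\{x,y\}$ is an edge of $G$. - The chain is irreducible, aperiodic, lazy ($P(x,x)\ge1/2$), and reversible with respect to its stationary distribution $\pi$: $\pi(x)P(x,y)=\pi(y)P(y,x)$. - The initial distribution is arbitrary. Accumulated homology: - Fix a spanning tree $T_G$ of $G$, and let $e_1,\dots,e_g$ be the edges of $G$ not in $T_G$. - Orient each $e_i$ as $(x_i,y_i)$. - For the path $\rho_X(t)=(X_0,\dots,X_t)$, the accumulated homology is $H_1(\rho_X(t))=(h_1,\dots,h_g)\in\mathbb{Z}^g$, where \[ h_i=\#\{j: X_j=x_i,\,X_{j+1}=y_i\}-\#\{j: X_j=y_i,\,X_{j+1}=x_i\}. \] This is the class in $H_1(G)$ of the loop obtained by closing $\rho_X(t)$ with the path in $T_G$ from $X_t$ to $X_0$, written in the basis given by the $e_i$. *)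

theory Defs
  imports "HOL-Probability.Probability" "Graph_Theory.Digraph_Component"
begin

text \<open>
  A finite simple graph is a \<^const>\<open>pair_graph\<close>: a finite, symmetric, loop-free set of ordered pairs.
\<close>

definition edges :: "'a pair_pre_digraph \<Rightarrow> 'a set set" where
  "edges G = (\<lambda>(u, v). {u, v}) ` parcs G"

text \<open>
  The constant \<^const>\<open>Digraph_Component.spanning_tree\<close> is not used: it excludes only directed
  cycles, and in a symmetric digraph every edge $\{a,b\}$ yields the directed cycle $a,b,a$. Since
  the graphs here have no loops and no parallel arcs, the cycles of the undirected graph are
  exactly the directed cycles of length at least 3.
\<close>

definition undirected_spanning_tree :: "'a pair_pre_digraph \<Rightarrow> 'a pair_pre_digraph \<Rightarrow> bool" where
  "undirected_spanning_tree T G \<longleftrightarrow>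
     pair_graph T \<and> spanning (with_proj T) (with_proj G) \<and>
     Digraph_Component.connected (with_proj T) \<and>
     \<not> (\<exists>p. pre_digraph.cycle (with_proj T) p \<and> 3 \<le> length p)"

definition transition_matrix :: "'a set \<Rightarrow> ('a \<Rightarrow> 'a \<Rightarrow> real) \<Rightarrow> bool" where
  "transition_matrix V P \<longleftrightarrow>
     (\<forall>u\<in>V. (\<forall>v\<in>V. 0 \<le> P u v) \<and> (\<Sum>v\<in>V. P u v) = 1)"

primrec step_prob :: "'a set \<Rightarrow> ('a \<Rightarrow> 'a \<Rightarrow> real) \<Rightarrow> nat \<Rightarrow> 'a \<Rightarrow> 'a \<Rightarrow> real" where
  "step_prob V P 0 u v = (if u = v then 1 else 0)"
| "step_prob V P (Suc n) u v = (\<Sum>w\<in>V. P u w * step_prob V P n w v)"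

definition irreducible_chain :: "'a set \<Rightarrow> ('a \<Rightarrow> 'a \<Rightarrow> real) \<Rightarrow> bool" where
  "irreducible_chain V P \<longleftrightarrow> (\<forall>u\<in>V. \<forall>v\<in>V. \<exists>n. 0 < step_prob V P n u v)"

definition aperiodic_chain :: "'a set \<Rightarrow> ('a \<Rightarrow> 'a \<Rightarrow> real) \<Rightarrow> bool" where
  "aperiodic_chain V P \<longleftrightarrow> (\<forall>u\<in>V. Gcd {n. 0 < n \<and> 0 < step_prob V P n u u} = 1)"

definition lazy_chain :: "'a set \<Rightarrow> ('a \<Rightarrow> 'a \<Rightarrow> real) \<Rightarrow> bool" where
  "lazy_chain V P \<longleftrightarrow> (\<forall>u\<in>V. 1 / 2 \<le> P u u)"

definition stationary_distribution :: "'a set \<Rightarrow> ('a \<Rightarrow> 'a \<Rightarrow> real) \<Rightarrow> ('a \<Rightarrow> real) \<Rightarrow> bool" where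
  "stationary_distribution V P p \<longleftrightarrow>
     (\<forall>v\<in>V. 0 \<le> p v) \<and> (\<Sum>v\<in>V. p v) = 1 \<and> (\<forall>v\<in>V. (\<Sum>u\<in>V. p u * P u v) = p v)"

definition reversible_chain :: "'a set \<Rightarrow> ('a \<Rightarrow> 'a \<Rightarrow> real) \<Rightarrow> ('a \<Rightarrow> real) \<Rightarrow> bool" where
  "reversible_chain V P p \<longleftrightarrow> (\<forall>u\<in>V. \<forall>v\<in>V. p u * P u v = p v * P v u)"

text \<open>
  The law of the initial state is unconstrained. Measurability into \<^term>\<open>count_space V\<close> includes
  that the chain takes values in \<^term>\<open>V\<close>.
\<close>

definition markov_chain ::
  "'w measure \<Rightarrow> 'a set \<Rightarrow> ('a \<Rightarrow> 'a \<Rightarrow> real) \<Rightarrow> (nat \<Rightarrow> 'w \<Rightarrow> 'a) \<Rightarrow> bool" where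
  "markov_chain M V P X \<longleftrightarrow>
     prob_space M \<and> (\<forall>t. X t \<in> measurable M (count_space V)) \<and>
     (\<forall>t s. \<forall>v\<in>V. \<P>(w in M. \<forall>j\<le>t. X j w = s j) \<noteq> 0 \<longrightarrow>
        \<P>(w in M. X (Suc t) w = v \<bar> \<forall>j\<le>t. X j w = s j) = P (s t) v)"

text \<open>
  The coordinates, with respect to the oriented non-tree edges $(x_i, y_i)$, of the accumulated
  homology of the path $r_0, \ldots, r_t$.
\<close>

definition accumulated_homology ::
  "(nat \<Rightarrow> 'a) \<Rightarrow> (nat \<Rightarrow> 'a) \<Rightarrow> (nat \<Rightarrow> 'a) \<Rightarrow> nat \<Rightarrow> nat \<Rightarrow> int" where
  "accumulated_homology x y r t i =
     int (card {j. j < t \<and> r j = x i \<and> r (Suc j) = y i}) -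
     int (card {j. j < t \<and> r j = y i \<and> r (Suc j) = x i})"

text \<open>
  Vectors in $\mathbb{R}^g$ are the extensional functions on \<^term>\<open>{..<g}\<close>, so that the dimension,
  which is determined by the graph and may be 0, is an ordinary natural number.
\<close>

abbreviation vec_borel :: "nat \<Rightarrow> (nat \<Rightarrow> real) measure" where
  "vec_borel g \<equiv> PiM {..<g} (\<lambda>_. borel)"

abbreviation vec_topology :: "nat \<Rightarrow> (nat \<Rightarrow> real) topology" where
  "vec_topology g \<equiv> product_topology (\<lambda>_. euclideanreal) {..<g}"

text \<open>Variance 0 is the point mass at the mean.\<close>

definition normal_law :: "real \<Rightarrow> real \<Rightarrow> real measure" where
  "normal_law m v =
     (if v = 0 then return borel m else density lborel (\<lambda>z. ennreal (normal_density m (sqrt v) z)))"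

text \<open>
  The law of a Gaussian vector: all linear functionals are (possibly degenerate) normal. This allows
  singular covariance matrices, for which there is no density. It implies that all the moments
  below exist, so no integrability has to be required.
\<close>

definition multivariate_normal ::
  "nat \<Rightarrow> (nat \<Rightarrow> real) \<Rightarrow> (nat \<Rightarrow> nat \<Rightarrow> real) \<Rightarrow> (nat \<Rightarrow> real) measure \<Rightarrow> bool" where
  "multivariate_normal g m S N \<longleftrightarrow>
     prob_space N \<and> sets N = sets (vec_borel g) \<and>
     (\<forall>a. \<exists>c v. 0 \<le> v \<and> distr N borel (\<lambda>z. \<Sum>i<g. a i * z i) = normal_law c v) \<and>
     (\<forall>i<g. (LINT z|N. z i) = m i) \<and>
     (\<forall>i<g. \<forall>j<g. (LINT z|N. (z i - m i) * (z j - m j)) = S i j)"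

definition weakly_converges ::
  "'b topology \<Rightarrow> (nat \<Rightarrow> 'b measure) \<Rightarrow> 'b measure \<Rightarrow> bool" where
  "weakly_converges U L N \<longleftrightarrow>
     (\<forall>f. continuous_map U euclideanreal f \<and> bounded (f ` topspace U) \<longrightarrow>
        (\<lambda>n. LINT z|L n. f z) \<longlonglongrightarrow> (LINT z|N. f z))"

end

theory Submission
  imports Defs "Jordan_Normal_Form.Determinant" "HOL-Real_Asymp.Real_Asymp"
begin

text \<open>
  Each coordinate of the accumulated homology is an additive functional
  $\sum_{j<t} f_i(X_j, X_{j+1})$ with $f_i$ antisymmetric, hence of stationary mean $0$ by
  reversibility. Solving a Poisson equation gives $h_i$ such that
  $m_i(u,v) = f_i(u,v) + h_i(v) - h_i(u)$ is a martingale increment; the limiting covariance is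
  $\sum_{u,v} \pi(u) P(u,v) m_i(u,v) m_j(u,v)$, visibly a Gram matrix.
  For a fixed linear combination, a second Poisson equation (correcting the conditional variance)
  yields an approximate eigenfunction of the twisted kernel $P(u,v) e^{i\theta f(u,v)}$ with
  eigenvalue $1 - \theta^2\sigma^2/2$ and error $O(\theta^3)$; iterating it $t$ times with
  $\theta = t^{-1/2}$ gives convergence of characteristic functions without a general martingale
  central limit theorem. Together with bounded second moments this implies weak convergence in
  $\mathbb{R}^g$, because bounded continuous functions are approximated on cubes by bounded
  trigonometric polynomials.
\<close>

section \<open>The Poisson equation of a finite irreducible chain\<close>

text \<open>The obstacle is that a one-step error is incurred t times. With the corrector h alone,
  the second-order term of the twisted kernel at u is the conditional variance at u, which varies
  with u; its deviation from the stationary mean costs order \<theta>^2 per step, and a step-by-step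
  bound would then be of order one when \<theta>^2 = 1/t. The second Poisson equation absorbs
  exactly this deviation, so that order \<theta>^3 per step and t^(-1/2) in total remain. It is
  solvable because c is the stationary mean of the conditional variance.

  The approximate eigenfunction tends to 1 uniformly over the finitely many states. It can therefore
  be inserted at time t and removed at time 0 at vanishing cost, which is why the limit is the same
  for every initial law.

  Since the covariance is a Gram matrix over pairs of states, the limit can be built as a linear
  image of independent standard normals, one per pair; singular covariances then need no separate
  treatment.\<close>

lemma linear_system_solvable:
  fixes A :: "'a \<Rightarrow> 'a \<Rightarrow> real"
  assumes fin: "finite V"
    and inj: "\<And>h. (\<forall>u\<in>V. (\<Sum>v\<in>V. A u v * h v) = 0) \<Longrightarrow> \<forall>v\<in>V. h v = 0"
  shows "\<exists>h. \<forall>u\<in>V. (\<Sum>v\<in>V. A u v * h v) = b u"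
proof -
  define n where "n = card V"
  obtain e where e: "bij_betw e {0..<n} V"
    using ex_bij_betw_nat_finite[OF fin] n_def by auto
  define d where "d = the_inv_into {0..<n} e"
  have de: "d (e i) = i" if "i < n" for i
    using e that by (auto simp: d_def bij_betw_def the_inv_into_f_f)
  have eV: "e i \<in> V" if "i < n" for i
    using e that by (auto simp: bij_betw_def)
  have surj: "\<exists>i<n. u = e i" if "u \<in> V" for u
    using e that by (force simp: bij_betw_def)
  define B where "B = mat n n (\<lambda>(i, j). A (e i) (e j))"
  have B: "B \<in> carrier_mat n n" by (simp add: B_def)
  have mult: "(B *\<^sub>v z) $ i = (\<Sum>v\<in>V. A (e i) v * z $ d v)" if "z \<in> carrier_vec n" "i < n" for z i
  proof -
    have "(B *\<^sub>v z) $ i = (\<Sum>j = 0..<n. A (e i) (e j) * z $ d (e j))"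
      using that by (auto simp: B_def scalar_prod_def de intro!: sum.cong)
    also have "\<dots> = (\<Sum>v\<in>V. A (e i) v * z $ d v)"
      by (rule sum.reindex_bij_betw[OF e])
    finally show ?thesis .
  qed
  \<comment> \<open>A kernel vector of \<open>B\<close> pulls back along \<open>d\<close> to a
    function killed by \<open>A\<close>. So injectivity makes the square matrix \<open>B\<close>
    invertible, and invertibility gives a solution for every right-hand side.\<close>
  have "Determinant.det B \<noteq> 0"
  proof
    assume "Determinant.det B = 0"
    then obtain z where z: "z \<in> carrier_vec n" "z \<noteq> 0\<^sub>v n" "B *\<^sub>v z = 0\<^sub>v n"
      using det_0_iff_vec_prod_zero[OF B] by auto
    have "\<forall>u\<in>V. (\<Sum>v\<in>V. A u v * z $ d v) = 0"
      using surj mult[OF z(1)] z(3) by fastforce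
    from inj[OF this] have "z $ i = 0" if "i < n" for i
      using eV[OF that] de[OF that] by force
    then have "z = 0\<^sub>v n" using z(1) by auto
    with z(2) show False ..
  qed
  then obtain C where C: "C \<in> carrier_mat n n" "B * C = 1\<^sub>m n"
    using det_non_zero_imp_unit[OF B, of "()"] by (auto simp: Units_def ring_mat_def)
  define z where "z = C *\<^sub>v vec n (\<lambda>i. b (e i))"
  have z: "z \<in> carrier_vec n" using C by (simp add: z_def)
  have "B *\<^sub>v z = (B * C) *\<^sub>v vec n (\<lambda>i. b (e i))"
    unfolding z_def by (rule assoc_mult_mat_vec[symmetric, OF B C(1)]) simp
  then have Bz: "B *\<^sub>v z = vec n (\<lambda>i. b (e i))" using C by simp
  have "(\<Sum>v\<in>V. A u v * z $ d v) = b u" if u: "u \<in> V" for u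
  proof -
    obtain i where i: "i < n" "u = e i" using surj[OF u] by blast
    show ?thesis using mult[OF z i(1)] i by (simp add: Bz)
  qed
  then show ?thesis by (intro exI[of _ "\<lambda>v. z $ d v"]) blast
qed

lemma step_prob_nonneg:
  assumes "transition_matrix V P" "u \<in> V" "v \<in> V"
  shows "0 \<le> step_prob V P n u v"
  using assms(2)
proof (induction n arbitrary: u)
  case (Suc n)
  then show ?case using assms by (auto simp: transition_matrix_def intro!: sum_nonneg)
qed simp

text \<open>Irreducibility only promises a positive probability after some number of steps, so
  harmonicity has to be available for \<open>n\<close> steps. The case of constant \<open>h\<close>
  says that the rows of the n-step matrix sum to 1.\<close>

lemma harmonic_step_prob:
  assumes fin: "finite V" and harm: "\<And>u. u \<in> V \<Longrightarrow> (\<Sum>v\<in>V. P u v * h v) = h u" and "u \<in> V"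
  shows "(\<Sum>v\<in>V. step_prob V P n u v * h v) = h u"
  using \<open>u \<in> V\<close>
proof (induction n arbitrary: u)
  case 0
  then show ?case using fin by (simp add: if_distrib[where f = "\<lambda>c. c * _"] cong: if_cong)
next
  case (Suc n)
  have "(\<Sum>v\<in>V. step_prob V P (Suc n) u v * h v)
      = (\<Sum>v\<in>V. \<Sum>w\<in>V. P u w * (step_prob V P n w v * h v))"
    by (simp add: sum_distrib_right mult.assoc)
  also have "\<dots> = (\<Sum>w\<in>V. P u w * (\<Sum>v\<in>V. step_prob V P n w v * h v))"
    by (subst sum.swap) (simp add: sum_distrib_left)
  also have "\<dots> = h u" using Suc harm by simp
  finally show ?case .
qed

text \<open>Maximum principle: at a maximiser \<open>u\<close> the maximum \<open>c\<close> is an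
  average of values that are at most \<open>c\<close>, so \<open>h\<close> equals \<open>c\<close>
  at every state that has positive weight in the average. Irreducibility reaches every
  state.\<close>

lemma harmonic_constant:
  assumes fin: "finite V" and tm: "transition_matrix V P" and irr: "irreducible_chain V P"
    and harm: "\<And>u. u \<in> V \<Longrightarrow> (\<Sum>v\<in>V. P u v * h v) = h u"
  shows "\<exists>c::real. \<forall>v\<in>V. h v = c"
proof (cases "V = {}")
  case False
  define c where "c = Max (h ` V)"
  have "c \<in> h ` V" using fin False unfolding c_def by (intro Max_in) auto
  then obtain u where u: "u \<in> V" "h u = c" by auto
  have le: "h v \<le> c" if "v \<in> V" for v using fin that by (simp add: c_def)
  have "h v = c" if v: "v \<in> V" for v
  proof -
    obtain n where n: "0 < step_prob V P n u v"
      using irr u v by (auto simp: irreducible_chain_def)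
    have one: "(\<Sum>w\<in>V. step_prob V P n u w * 1) = 1"
      using tm by (intro harmonic_step_prob[OF fin _ u(1), where h = "\<lambda>_. 1"])
        (simp add: transition_matrix_def)
    have "(\<Sum>w\<in>V. step_prob V P n u w * (c - h w))
        = c * (\<Sum>w\<in>V. step_prob V P n u w * 1) - (\<Sum>w\<in>V. step_prob V P n u w * h w)"
      by (simp add: algebra_simps sum_subtractf sum_distrib_left)
    also have "\<dots> = 0"
      using harmonic_step_prob[OF fin harm u(1)] u(2) by (simp only: one)
    finally have "\<forall>w\<in>V. step_prob V P n u w * (c - h w) = 0"
      using sum_nonneg_eq_0_iff[OF fin, of "\<lambda>w. step_prob V P n u w * (c - h w)"]
        step_prob_nonneg[OF tm u(1)] le by simp
    then show ?thesis using n v by force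
  qed
  then show ?thesis by blast
qed simp

text \<open>The operator I - P kills constants, so it is not invertible; adding the projection onto
  constants along \<open>p\<close> repairs this. The solution for the repaired operator has the same
  \<open>p\<close>-mean as \<open>b\<close>, namely 0, so the added term vanishes on it and the
  original equation holds.\<close>

lemma poisson_equation:
  assumes fin: "finite V" and tm: "transition_matrix V P" and irr: "irreducible_chain V P"
    and st: "stationary_distribution V P p" and b: "(\<Sum>u\<in>V. p u * b u) = 0"
  shows "\<exists>h. \<forall>u\<in>V. h u - (\<Sum>v\<in>V. P u v * h v) = b u"
proof -
  define A where "A u v = (if u = v then 1 else 0) - P u v + p v" for u v
  have A: "(\<Sum>v\<in>V. A u v * h v) = h u - (\<Sum>v\<in>V. P u v * h v) + (\<Sum>v\<in>V. p v * h v)"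
    if "u \<in> V" for u and h :: "'a \<Rightarrow> real"
  proof -
    have "(\<Sum>v\<in>V. A u v * h v)
        = (\<Sum>v\<in>V. (if u = v then h v else 0) - P u v * h v + p v * h v)"
      by (intro sum.cong refl) (simp add: A_def algebra_simps)
    then show ?thesis using that fin by (simp add: sum.distrib sum_subtractf)
  qed
  have p1: "(\<Sum>u\<in>V. p u) = 1" and pP: "\<And>v. v \<in> V \<Longrightarrow> (\<Sum>u\<in>V. p u * P u v) = p v"
    using st by (auto simp: stationary_distribution_def)
  \<comment> \<open>Averaging against \<open>p\<close> kills \<open>I - P\<close> and leaves the rank-one term of \<open>A\<close>, so \<open>A\<close> is injective.\<close>
  have mean: "(\<Sum>u\<in>V. p u * (\<Sum>v\<in>V. A u v * h v)) = (\<Sum>v\<in>V. p v * h v)" for h :: "'a \<Rightarrow> real"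
  proof -
    have "(\<Sum>u\<in>V. p u * (\<Sum>v\<in>V. P u v * h v)) = (\<Sum>v\<in>V. (\<Sum>u\<in>V. p u * P u v) * h v)"
      by (simp add: sum_distrib_left sum_distrib_right mult.assoc) (rule sum.swap)
    also have "\<dots> = (\<Sum>v\<in>V. p v * h v)" using pP by simp
    finally have eq: "(\<Sum>u\<in>V. p u * (\<Sum>v\<in>V. P u v * h v)) = (\<Sum>v\<in>V. p v * h v)" .
    have "(\<Sum>u\<in>V. p u * (\<Sum>v\<in>V. A u v * h v))
        = (\<Sum>u\<in>V. p u * h u - p u * (\<Sum>v\<in>V. P u v * h v) + p u * (\<Sum>v\<in>V. p v * h v))"
      by (intro sum.cong refl) (simp add: A right_diff_distrib distrib_left)
    also have "\<dots> = (\<Sum>v\<in>V. p v * h v)"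
      using p1 by (simp add: sum.distrib sum_subtractf eq flip: sum_distrib_right)
    finally show ?thesis .
  qed
  have "\<exists>h. \<forall>u\<in>V. (\<Sum>v\<in>V. A u v * h v) = b u"
  proof (rule linear_system_solvable[OF fin])
    fix h assume h: "\<forall>u\<in>V. (\<Sum>v\<in>V. A u v * h v) = 0"
    then have ph: "(\<Sum>v\<in>V. p v * h v) = 0" using mean[of h] by simp
    have "(\<Sum>v\<in>V. P u v * h v) = h u" if "u \<in> V" for u
      using A[OF that, of h] h that ph by simp
    from harmonic_constant[OF fin tm irr this] obtain c where c: "\<forall>v\<in>V. h v = c" by blast
    have "(\<Sum>v\<in>V. p v * h v) = c" using c p1 by (simp flip: sum_distrib_right)
    with c ph show "\<forall>v\<in>V. h v = 0" by simp
  qed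
  then obtain h where h: "\<forall>u\<in>V. (\<Sum>v\<in>V. A u v * h v) = b u" by blast
  then have "(\<Sum>v\<in>V. p v * h v) = 0" using mean[of h] b by simp
  with h A[of _ h] show ?thesis by (intro exI[of _ h]) auto
qed

section \<open>Path functionals of a finite Markov chain\<close>

locale finite_markov_chain =
  fixes M :: "'w measure" and V :: "'a set" and P :: "'a \<Rightarrow> 'a \<Rightarrow> real" and X :: "nat \<Rightarrow> 'w \<Rightarrow> 'a"
  assumes finite_states: "finite V" and transition: "transition_matrix V P"
    and chain: "markov_chain M V P X"
begin

sublocale prob_space M using chain by (simp add: markov_chain_def)

lemma measurable_state [measurable]: "X t \<in> measurable M (count_space V)"
  using chain by (simp add: markov_chain_def)

lemma state_in [simp]: "w \<in> space M \<Longrightarrow> X t w \<in> V"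
  using measurable_space[OF measurable_state] by fastforce

lemma P_nonneg: "u \<in> V \<Longrightarrow> v \<in> V \<Longrightarrow> 0 \<le> P u v"
  and P_sum: "u \<in> V \<Longrightarrow> (\<Sum>v\<in>V. P u v) = 1"
  using transition by (auto simp: transition_matrix_def)

definition cylinder :: "nat \<Rightarrow> (nat \<Rightarrow> 'a) \<Rightarrow> 'w set" where
  "cylinder t s = {w \<in> space M. \<forall>j\<le>t. X j w = s j}"

lemma state_event [measurable]: "{w \<in> space M. X j w = v} \<in> sets M"
proof -
  have "{w \<in> space M. X j w = v} = X j -` ({v} \<inter> V) \<inter> space M" by auto
  then show ?thesis using measurable_sets[OF measurable_state, of "{v} \<inter> V" j] by simp
qed

lemma cylinder_event [measurable]: "cylinder t s \<in> sets M"
proof -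
  have "cylinder t s = (\<Inter>j\<in>{..t}. {w \<in> space M. X j w = s j})" by (auto simp: cylinder_def)
  also have "\<dots> \<in> sets M" by (intro sets.finite_INT) auto
  finally show ?thesis .
qed

text \<open>Functionals live on infinite sequences, not on tuples of length \<open>t + 1\<close>, so
  they have one type for all times. Being adapted is then this predicate, without a
  filtration.\<close>

definition determined_by :: "nat \<Rightarrow> ((nat \<Rightarrow> 'a) \<Rightarrow> 'b) \<Rightarrow> bool" where
  "determined_by t F \<longleftrightarrow> (\<forall>r s. (\<forall>j\<le>t. r j = s j) \<longrightarrow> F r = F s)"

text \<open>Extensionality gives every initial segment exactly one representative, so the cylinders
  over \<open>paths t\<close> partition the sample space.\<close>

abbreviation paths :: "nat \<Rightarrow> (nat \<Rightarrow> 'a) set" where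
  "paths t \<equiv> PiE {..t} (\<lambda>_. V)"

lemma finite_paths: "finite (paths t)"
  using finite_states by (intro finite_PiE) auto

text \<open>Finitely many states make every such functional a simple function of the sample point.
  Hence integrability below asks neither measurability nor boundedness of \<open>F\<close>.\<close>

lemma path_decomposition:
  fixes F :: "(nat \<Rightarrow> 'a) \<Rightarrow> 'b::real_vector"
  assumes F: "determined_by t F" and w: "w \<in> space M"
  shows "F (\<lambda>j. X j w) = (\<Sum>s\<in>paths t. indicat_real (cylinder t s) w *\<^sub>R F s)"
proof -
  let ?r = "restrict (\<lambda>j. X j w) {..t}"
  have "indicat_real (cylinder t s) w *\<^sub>R F s = (if s = ?r then F s else 0)" if "s \<in> paths t" for s
  proof -
    have "w \<in> cylinder t s \<longleftrightarrow> s = ?r"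
      using w that by (auto simp: cylinder_def fun_eq_iff PiE_def extensional_def)
    then show ?thesis by (simp add: indicator_def)
  qed
  then have "(\<Sum>s\<in>paths t. indicat_real (cylinder t s) w *\<^sub>R F s)
      = (\<Sum>s\<in>paths t. if s = ?r then F s else 0)"
    by (intro sum.cong refl) blast
  also have "\<dots> = F ?r" using w finite_paths by (simp add: sum.delta PiE_def)
  also have "\<dots> = F (\<lambda>j. X j w)" using F by (auto simp: determined_by_def)
  finally show ?thesis by simp
qed

lemma integrable_path_functional:
  fixes F :: "(nat \<Rightarrow> 'a) \<Rightarrow> 'b::{banach, second_countable_topology}"
  assumes F: "determined_by t F"
  shows "integrable M (\<lambda>w. F (\<lambda>j. X j w))"
proof -
  have "integrable M (\<lambda>w. \<Sum>s\<in>paths t. indicat_real (cylinder t s) w *\<^sub>R F s)"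
    by (intro Bochner_Integration.integrable_sum integrable_scaleR_left) (simp add: emeasure_eq_measure)
  also have "?this \<longleftrightarrow> ?thesis"
    using path_decomposition[OF F] by (intro Bochner_Integration.integrable_cong) auto
  finally show ?thesis .
qed

lemma integral_path_functional:
  fixes F :: "(nat \<Rightarrow> 'a) \<Rightarrow> 'b::{banach, second_countable_topology}"
  assumes F: "determined_by t F"
  shows "(LINT w|M. F (\<lambda>j. X j w)) = (\<Sum>s\<in>paths t. prob (cylinder t s) *\<^sub>R F s)"
proof -
  have "(LINT w|M. F (\<lambda>j. X j w))
      = (LINT w|M. (\<Sum>s\<in>paths t. indicat_real (cylinder t s) w *\<^sub>R F s))"
    using path_decomposition[OF F] by (intro Bochner_Integration.integral_cong) auto
  also have "\<dots> = (\<Sum>s\<in>paths t. LINT w|M. indicat_real (cylinder t s) w *\<^sub>R F s)"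
    by (intro Bochner_Integration.integral_sum integrable_scaleR_left) (simp add: emeasure_eq_measure)
  also have "\<dots> = (\<Sum>s\<in>paths t. prob (cylinder t s) *\<^sub>R F s)"
    by (intro sum.cong refl) (simp add: emeasure_eq_measure sets.Int_space_eq2)
  finally show ?thesis .
qed

text \<open>The Markov property is assumed only given histories of positive probability. For a null
  history both sides are 0, so the product form holds without exception and can be summed over all
  paths.\<close>

lemma prob_cylinder_step:
  assumes "v \<in> V"
  shows "prob (cylinder t s \<inter> {w \<in> space M. X (Suc t) w = v}) = prob (cylinder t s) * P (s t) v"
proof (cases "prob (cylinder t s) = 0")
  case True
  have "prob (cylinder t s \<inter> {w \<in> space M. X (Suc t) w = v}) \<le> prob (cylinder t s)"
    by (intro finite_measure_mono) auto
  with True show ?thesis by (simp add: measure_le_0_iff)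
next
  case False
  have "\<P>(w in M. X (Suc t) w = v \<bar> \<forall>j\<le>t. X j w = s j) = P (s t) v"
    using chain assms False by (auto simp: markov_chain_def cylinder_def)
  moreover have "{w \<in> space M. X (Suc t) w = v \<and> (\<forall>j\<le>t. X j w = s j)}
      = cylinder t s \<inter> {w \<in> space M. X (Suc t) w = v}" by (auto simp: cylinder_def)
  ultimately show ?thesis using False by (simp add: cond_prob_def cylinder_def field_simps)
qed

lemma determined_by_average:
  fixes K :: "(nat \<Rightarrow> 'a) \<Rightarrow> 'a \<Rightarrow> 'b::real_vector"
  assumes "\<And>v. determined_by t (\<lambda>r. K r v)"
  shows "determined_by t (\<lambda>r. \<Sum>v\<in>V. P (r t) v *\<^sub>R K r v)"
  unfolding determined_by_def
proof (intro allI impI)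
  fix r s :: "nat \<Rightarrow> 'a"
  assume rs: "\<forall>j\<le>t. r j = s j"
  then have "K r v = K s v" for v using assms by (auto simp: determined_by_def)
  with rs show "(\<Sum>v\<in>V. P (r t) v *\<^sub>R K r v) = (\<Sum>v\<in>V. P (s t) v *\<^sub>R K s v)" by simp
qed

text \<open>This is the tower property given the first \<open>t\<close> steps, phrased for integrals
  so that no conditional expectation appears: the new state is replaced by its average under the
  current row of \<open>P\<close>.\<close>

lemma markov_step:
  fixes K :: "(nat \<Rightarrow> 'a) \<Rightarrow> 'a \<Rightarrow> 'b::{banach, second_countable_topology}"
  assumes K: "\<And>v. determined_by t (\<lambda>r. K r v)"
  shows "(LINT w|M. K (\<lambda>j. X j w) (X (Suc t) w))
       = (LINT w|M. (\<Sum>v\<in>V. P (X t w) v *\<^sub>R K (\<lambda>j. X j w) v))"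
proof -
  let ?E = "\<lambda>v. {w \<in> space M. X (Suc t) w = v}"
  have "(LINT w|M. K (\<lambda>j. X j w) (X (Suc t) w))
      = (LINT w|M. (\<Sum>s\<in>paths t. \<Sum>v\<in>V. indicat_real (cylinder t s \<inter> ?E v) w *\<^sub>R K s v))"
  proof (intro Bochner_Integration.integral_cong refl)
    fix w assume w: "w \<in> space M"
    have "K (\<lambda>j. X j w) (X (Suc t) w) = (\<Sum>v\<in>V. indicat_real (?E v) w *\<^sub>R K (\<lambda>j. X j w) v)"
    proof -
      have "indicat_real (?E v) w *\<^sub>R K (\<lambda>j. X j w) v
          = (if X (Suc t) w = v then K (\<lambda>j. X j w) v else 0)" for v
        using w by (simp add: indicator_def)
      then show ?thesis using w finite_states by (simp only: sum.delta' state_in if_True)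
    qed
    also have "\<dots> = (\<Sum>v\<in>V. \<Sum>s\<in>paths t. indicat_real (cylinder t s \<inter> ?E v) w *\<^sub>R K s v)"
    proof (intro sum.cong refl)
      fix v
      show "indicat_real (?E v) w *\<^sub>R K (\<lambda>j. X j w) v
          = (\<Sum>s\<in>paths t. indicat_real (cylinder t s \<inter> ?E v) w *\<^sub>R K s v)"
        by (subst path_decomposition[OF K w])
          (auto simp: scaleR_sum_right indicator_inter_arith mult.commute)
    qed
    finally show "K (\<lambda>j. X j w) (X (Suc t) w)
        = (\<Sum>s\<in>paths t. \<Sum>v\<in>V. indicat_real (cylinder t s \<inter> ?E v) w *\<^sub>R K s v)"
      by (subst sum.swap)
  qed
  also have "\<dots> = (\<Sum>s\<in>paths t. \<Sum>v\<in>V. LINT w|M. indicat_real (cylinder t s \<inter> ?E v) w *\<^sub>R K s v)"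
    by (subst Bochner_Integration.integral_sum | intro sum.cong refl Bochner_Integration.integrable_sum integrable_scaleR_left
       | simp add: emeasure_eq_measure)+
  also have "\<dots> = (\<Sum>s\<in>paths t. \<Sum>v\<in>V. (prob (cylinder t s) * P (s t) v) *\<^sub>R K s v)"
    by (intro sum.cong refl) (simp add: emeasure_eq_measure sets.Int_space_eq2 prob_cylinder_step)
  also have "\<dots> = (\<Sum>s\<in>paths t. prob (cylinder t s) *\<^sub>R (\<Sum>v\<in>V. P (s t) v *\<^sub>R K s v))"
    by (simp add: scaleR_sum_right)
  also have "\<dots> = (LINT w|M. (\<Sum>v\<in>V. P (X t w) v *\<^sub>R K (\<lambda>j. X j w) v))"
    by (rule integral_path_functional[OF determined_by_average, symmetric]) (rule K)
  finally show ?thesis .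
qed

end

section \<open>Central limit theorem for additive functionals\<close>

text \<open>One row of the twisted kernel, with \<open>q\<close> the row at a state,
  \<open>m\<close> the martingale increments and \<open>z0\<close> the value of \<open>z\<close>
  there. \<open>centred\<close> removes order \<theta> and \<open>second\<close> matches order
  \<theta>^2. The remaining terms are the cubic Taylor remainder (\<open>B ^ 3 / 6\<close>), the
  interaction of the phase with the correction (\<open>B * W / 2\<close>), and the \<theta>^4 term
  created by multiplying out the product on the right
  (\<open>\<bar>c\<bar> * W / 4\<close>).\<close>

lemma perturbed_kernel_expansion:
  fixes q m z :: "'a \<Rightarrow> real"
  assumes fin: "finite V" and q: "\<And>v. v \<in> V \<Longrightarrow> 0 \<le> q v" and q1: "(\<Sum>v\<in>V. q v) = 1"
    and m: "\<And>v. v \<in> V \<Longrightarrow> \<bar>m v\<bar> \<le> B" and z: "\<And>v. v \<in> V \<Longrightarrow> \<bar>z v\<bar> \<le> W" and z0: "\<bar>z0\<bar> \<le> W"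
    and centred: "(\<Sum>v\<in>V. q v * m v) = 0"
    and second: "(\<Sum>v\<in>V. q v * (m v)\<^sup>2) + (\<Sum>v\<in>V. q v * z v) = c + z0"
  shows "cmod ((\<Sum>v\<in>V. of_real (q v) * (iexp (\<theta> * m v) * of_real (1 - \<theta>\<^sup>2 * z v / 2)))
           - of_real ((1 - \<theta>\<^sup>2 * c / 2) * (1 - \<theta>\<^sup>2 * z0 / 2)))
         \<le> \<bar>\<theta>\<bar> ^ 3 * (B ^ 3 / 6 + B * W / 2) + \<theta> ^ 4 * (\<bar>c\<bar> * W / 4)"
proof -
  \<comment> \<open>Two remainders of different order: \<open>r\<close> goes with the leading 1 and
    must be cubic in \<theta>, whereas \<open>r'\<close> is multiplied by \<theta>^2 and only has to
    be linear.\<close>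
  define r where "r v = iexp (\<theta> * m v) - of_real (1 - \<theta>\<^sup>2 * (m v)\<^sup>2 / 2) - \<i> * of_real (\<theta> * m v)" for v
  define r' where "r' v = iexp (\<theta> * m v) - 1" for v
  have r: "cmod (r v) \<le> \<bar>\<theta>\<bar> ^ 3 * B ^ 3 / 6" if "v \<in> V" for v
  proof -
    have "r v = iexp (\<theta> * m v) - (\<Sum>k\<le>2. (\<i> * complex_of_real (\<theta> * m v)) ^ k / fact k)"
      by (simp add: r_def numeral_2_eq_2 power_mult_distrib algebra_simps)
    then have "cmod (r v) \<le> \<bar>\<theta> * m v\<bar> ^ 3 / 6"
      using iexp_approx1[of "\<theta> * m v" 2] by (simp add: eval_nat_numeral)
    also have "\<dots> \<le> (\<bar>\<theta>\<bar> * B) ^ 3 / 6"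
      using m[OF that] by (intro divide_right_mono power_mono) (auto simp: abs_mult mult_left_mono)
    finally show ?thesis by (simp add: power_mult_distrib)
  qed
  have r': "cmod (r' v) \<le> \<bar>\<theta>\<bar> * B" if "v \<in> V" for v
  proof -
    have "cmod (r' v) \<le> \<bar>\<theta> * m v\<bar>" using iexp_approx1[of "\<theta> * m v" 0] by (simp add: r'_def)
    also have "\<dots> \<le> \<bar>\<theta>\<bar> * B" using m[OF that] by (simp add: abs_mult mult_left_mono)
    finally show ?thesis .
  qed
  have split: "iexp (\<theta> * m v) * of_real (1 - \<theta>\<^sup>2 * z v / 2)
      = of_real (1 - \<theta>\<^sup>2 * (m v)\<^sup>2 / 2 - \<theta>\<^sup>2 * z v / 2) + \<i> * of_real (\<theta> * m v)
        + (r v - of_real (\<theta>\<^sup>2 * z v / 2) * r' v)" for v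
    by (simp add: r_def r'_def field_simps)
  have re: "(\<Sum>v\<in>V. q v * (1 - \<theta>\<^sup>2 * (m v)\<^sup>2 / 2 - \<theta>\<^sup>2 * z v / 2)) = 1 - \<theta>\<^sup>2 / 2 * (c + z0)"
  proof -
    have "(\<Sum>v\<in>V. q v * (1 - \<theta>\<^sup>2 * (m v)\<^sup>2 / 2 - \<theta>\<^sup>2 * z v / 2))
        = (\<Sum>v\<in>V. q v - \<theta>\<^sup>2 / 2 * (q v * (m v)\<^sup>2) - \<theta>\<^sup>2 / 2 * (q v * z v))"
      by (intro sum.cong refl) (simp add: algebra_simps)
    also have "\<dots> = 1 - \<theta>\<^sup>2 / 2 * ((\<Sum>v\<in>V. q v * (m v)\<^sup>2) + (\<Sum>v\<in>V. q v * z v))"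
      by (simp only: sum_subtractf q1 flip: sum_distrib_left) (simp add: algebra_simps)
    finally show ?thesis by (simp only: second)
  qed
  have "(\<Sum>v\<in>V. of_real (q v) * (iexp (\<theta> * m v) * of_real (1 - \<theta>\<^sup>2 * z v / 2)))
      = (\<Sum>v\<in>V. of_real (q v * (1 - \<theta>\<^sup>2 * (m v)\<^sup>2 / 2 - \<theta>\<^sup>2 * z v / 2))
          + \<i> * of_real \<theta> * of_real (q v * m v)
          + of_real (q v) * (r v - of_real (\<theta>\<^sup>2 * z v / 2) * r' v))"
    by (intro sum.cong refl) (simp only: split, simp add: algebra_simps)
  also have "\<dots> = of_real (\<Sum>v\<in>V. q v * (1 - \<theta>\<^sup>2 * (m v)\<^sup>2 / 2 - \<theta>\<^sup>2 * z v / 2))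
      + \<i> * of_real \<theta> * of_real (\<Sum>v\<in>V. q v * m v)
      + (\<Sum>v\<in>V. of_real (q v) * (r v - of_real (\<theta>\<^sup>2 * z v / 2) * r' v))"
    by (simp only: sum.distrib of_real_sum flip: sum_distrib_left)
  also have "\<dots> = of_real (1 - \<theta>\<^sup>2 / 2 * (c + z0))
      + (\<Sum>v\<in>V. of_real (q v) * (r v - of_real (\<theta>\<^sup>2 * z v / 2) * r' v))"
    by (simp only: re centred) simp
  finally have eq0: "(\<Sum>v\<in>V. of_real (q v) * (iexp (\<theta> * m v) * of_real (1 - \<theta>\<^sup>2 * z v / 2)))
      = of_real (1 - \<theta>\<^sup>2 / 2 * (c + z0))
      + (\<Sum>v\<in>V. of_real (q v) * (r v - of_real (\<theta>\<^sup>2 * z v / 2) * r' v))" .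
  have eq: "(\<Sum>v\<in>V. of_real (q v) * (iexp (\<theta> * m v) * of_real (1 - \<theta>\<^sup>2 * z v / 2)))
        - of_real ((1 - \<theta>\<^sup>2 * c / 2) * (1 - \<theta>\<^sup>2 * z0 / 2))
      = (\<Sum>v\<in>V. of_real (q v) * (r v - of_real (\<theta>\<^sup>2 * z v / 2) * r' v))
        - of_real (\<theta> ^ 4 * (c * z0 / 4))"
    unfolding eq0 by (simp only: add_diff_eq[symmetric] add.commute[of "of_real _"] add_left_cancel flip: of_real_diff)
      (simp add: field_simps power2_eq_square power4_eq_xxxx)
  have "cmod (\<Sum>v\<in>V. of_real (q v) * (r v - of_real (\<theta>\<^sup>2 * z v / 2) * r' v))
      \<le> (\<Sum>v\<in>V. q v * (\<bar>\<theta>\<bar> ^ 3 * (B ^ 3 / 6 + B * W / 2)))"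
  proof (rule sum_norm_le)
    fix v assume v: "v \<in> V"
    have "cmod (of_real (\<theta>\<^sup>2 * z v / 2) * r' v) \<le> (\<theta>\<^sup>2 * W / 2) * (\<bar>\<theta>\<bar> * B)"
      unfolding norm_mult norm_of_real using r'[OF v] z[OF v]
      by (intro mult_mono) (auto simp: abs_mult intro!: mult_left_mono)
    also have "\<dots> = \<bar>\<theta>\<bar> ^ 3 * (B * W / 2)"
      by (simp add: power3_eq_cube power2_eq_square abs_mult_self_eq)
    finally have "cmod (r v - of_real (\<theta>\<^sup>2 * z v / 2) * r' v) \<le> \<bar>\<theta>\<bar> ^ 3 * (B ^ 3 / 6 + B * W / 2)"
      using r[OF v] norm_triangle_ineq4[of "r v" "of_real (\<theta>\<^sup>2 * z v / 2) * r' v"]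
      by (simp add: algebra_simps)
    then show "cmod (of_real (q v) * (r v - of_real (\<theta>\<^sup>2 * z v / 2) * r' v))
        \<le> q v * (\<bar>\<theta>\<bar> ^ 3 * (B ^ 3 / 6 + B * W / 2))"
      unfolding norm_mult using q[OF v] by (simp add: mult_left_mono)
  qed
  also have "\<dots> = \<bar>\<theta>\<bar> ^ 3 * (B ^ 3 / 6 + B * W / 2)" by (simp add: q1 flip: sum_distrib_right)
  finally have 1: "cmod (\<Sum>v\<in>V. of_real (q v) * (r v - of_real (\<theta>\<^sup>2 * z v / 2) * r' v))
      \<le> \<bar>\<theta>\<bar> ^ 3 * (B ^ 3 / 6 + B * W / 2)" .
  have 2: "cmod (of_real (\<theta> ^ 4 * (c * z0 / 4))) \<le> \<theta> ^ 4 * (\<bar>c\<bar> * W / 4)"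
    using z0 by (simp only: norm_of_real abs_mult) (auto simp: abs_mult power_abs intro!: mult_left_mono)
  show ?thesis unfolding eq using norm_triangle_ineq4 1 2 by (meson add_mono order_trans)
qed

text \<open>A multiplier of modulus at most 1 does not amplify earlier errors, so they add up only
  linearly in \<open>t\<close>.\<close>

lemma approximate_geometric:
  fixes a :: "nat \<Rightarrow> complex"
  assumes step: "\<And>t. cmod (a (Suc t) - of_real l * a t) \<le> d" and l: "\<bar>l\<bar> \<le> 1"
  shows "cmod (a t - of_real l ^ t * a 0) \<le> real t * d"
proof (induction t)
  case (Suc t)
  have "a (Suc t) - of_real l ^ Suc t * a 0
      = (a (Suc t) - of_real l * a t) + of_real l * (a t - of_real l ^ t * a 0)"
    by (simp add: algebra_simps)
  also have "cmod \<dots> \<le> cmod (a (Suc t) - of_real l * a t) + \<bar>l\<bar> * cmod (a t - of_real l ^ t * a 0)"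
    by (rule order_trans[OF norm_triangle_ineq]) (simp add: norm_mult)
  also have "\<dots> \<le> d + 1 * (real t * d)"
    using step[of t] Suc l by (intro add_mono mult_mono) auto
  finally show ?case by (simp add: algebra_simps)
qed simp

section \<open>Additive functionals: limiting characteristic function and second moment\<close>

context finite_markov_chain
begin

definition additive_functional :: "('a \<Rightarrow> 'a \<Rightarrow> real) \<Rightarrow> nat \<Rightarrow> (nat \<Rightarrow> 'a) \<Rightarrow> real" where
  "additive_functional f t r = (\<Sum>j<t. f (r j) (r (Suc j)))"

lemma additive_functional_Suc:
  "additive_functional f (Suc t) r = additive_functional f t r + f (r t) (r (Suc t))"
  by (simp add: additive_functional_def)

lemma determined_by_additive_functional:
  "determined_by t (\<lambda>r. F (additive_functional f t r) (r t))"
proof -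
  have "additive_functional f t r = additive_functional f t s" if "\<forall>j\<le>t. r j = s j" for r s
    using that by (auto simp: additive_functional_def intro!: sum.cong)
  then show ?thesis by (simp add: determined_by_def) (metis order_refl)
qed

lemma states_bound: "\<exists>B. \<forall>v\<in>V. \<bar>h v :: real\<bar> \<le> B"
  using finite_states finite_imageI[of V "\<lambda>v. \<bar>h v\<bar>"]
  by (intro exI[of _ "Max ((\<lambda>v. \<bar>h v\<bar>) ` V)"]) simp

lemma pairs_bound: "\<exists>B. \<forall>u\<in>V. \<forall>v\<in>V. \<bar>f u v :: real\<bar> \<le> B"
proof -
  have "finite ((\<lambda>(u, v). \<bar>f u v\<bar>) ` (V \<times> V))" using finite_states by blast
  then have "\<bar>f u v\<bar> \<le> Max ((\<lambda>(u, v). \<bar>f u v\<bar>) ` (V \<times> V))" if "u \<in> V" "v \<in> V" for u v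
    using that by (intro Max_ge) force+
  then show ?thesis by blast
qed

text \<open>
  \<open>iexp (\<theta> h) (1 - \<theta>\<^sup>2 z / 2)\<close> is an approximate eigenfunction, with eigenvalue
  \<open>1 - \<theta>\<^sup>2 c / 2\<close> and error of order \<open>\<theta>\<^sup>3\<close>, of the transition kernel twisted by \<open>iexp (\<theta> f)\<close>.
\<close>

lemma additive_functional_clt:
  assumes h: "\<And>u. u \<in> V \<Longrightarrow> (\<Sum>v\<in>V. P u v * (f u v + h v - h u)) = 0"
    and z: "\<And>u. u \<in> V \<Longrightarrow>
      (\<Sum>v\<in>V. P u v * (f u v + h v - h u)\<^sup>2) + (\<Sum>v\<in>V. P u v * z v) = c + z u"
    and "0 \<le> c"
  shows "(\<lambda>n. LINT w|M. iexp (additive_functional f n (\<lambda>j. X j w) / sqrt (real n)))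
           \<longlonglongrightarrow> of_real (exp (- c / 2))"
proof -
  define m where "m u v = f u v + h v - h u" for u v
  obtain B H W where B: "\<And>u v. u \<in> V \<Longrightarrow> v \<in> V \<Longrightarrow> \<bar>m u v\<bar> \<le> B"
    and H: "\<And>v. v \<in> V \<Longrightarrow> \<bar>h v\<bar> \<le> H" and W: "\<And>v. v \<in> V \<Longrightarrow> \<bar>z v\<bar> \<le> W"
    using pairs_bound[of m] states_bound[of h] states_bound[of z] by metis
  define D where "D = B ^ 3 / 6 + B * W / 2"
  define S where "S t w = additive_functional f t (\<lambda>j. X j w)" for t w
  define \<phi> where "\<phi> \<theta> v = iexp (\<theta> * h v) * of_real (1 - \<theta>\<^sup>2 * z v / 2)" for \<theta> v
  \<comment> \<open>The expected path weight tested against the approximate eigenfunction. Advancing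
    time by one applies the twisted kernel to \<open>\<phi> \<theta>\<close>, so for fixed \<theta>
    this sequence is nearly geometric.\<close>
  define a where "a \<theta> t = (LINT w|M. iexp (\<theta> * S t w) * \<phi> \<theta> (X t w))" for \<theta> t
  have int_a: "integrable M (\<lambda>w. iexp (\<theta> * S t w) * \<phi> \<theta> (X t w))" for \<theta> t
    unfolding S_def
    by (rule integrable_path_functional[OF determined_by_additive_functional[of t "\<lambda>x v. iexp (\<theta> * x) * \<phi> \<theta> v" f]])
  have int_e: "integrable M (\<lambda>w. iexp (\<theta> * S t w))" for \<theta> t
    unfolding S_def
    by (rule integrable_path_functional[OF determined_by_additive_functional[of t "\<lambda>x v. iexp (\<theta> * x)" f]])
  have \<phi>_near: "cmod (\<phi> \<theta> v - 1) \<le> \<bar>\<theta>\<bar> * H + \<theta>\<^sup>2 * W / 2" if v: "v \<in> V" for \<theta> v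
  proof -
    have "\<phi> \<theta> v - 1 = (iexp (\<theta> * h v) - 1) - iexp (\<theta> * h v) * of_real (\<theta>\<^sup>2 * z v / 2)"
      by (simp add: \<phi>_def algebra_simps)
    also have "cmod \<dots> \<le> cmod (iexp (\<theta> * h v) - 1) + cmod (iexp (\<theta> * h v) * of_real (\<theta>\<^sup>2 * z v / 2))"
      by (rule norm_triangle_ineq4)
    also have "\<dots> = cmod (iexp (\<theta> * h v) - 1) + \<bar>\<theta>\<^sup>2 * z v / 2\<bar>"
      by (simp only: norm_mult norm_exp_i_times norm_of_real mult_1)
    also have "\<dots> \<le> \<bar>\<theta> * h v\<bar> + \<bar>\<theta>\<^sup>2 * z v / 2\<bar>"
      using iexp_approx1[of "\<theta> * h v" 0] by simp
    also have "\<dots> \<le> \<bar>\<theta>\<bar> * H + \<theta>\<^sup>2 * W / 2"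
      using mult_left_mono[OF H[OF v], of "\<bar>\<theta>\<bar>"] mult_left_mono[OF W[OF v], of "\<theta>\<^sup>2"]
      by (simp add: abs_mult)
    finally show ?thesis .
  qed
  \<comment> \<open>No integrability is required: otherwise the integral is 0 by convention, and
    \<open>d\<close> is nonnegative because the sample space is nonempty.\<close>
  have const: "cmod (LINT w|M. g w) \<le> d"
    if "\<And>w. w \<in> space M \<Longrightarrow> cmod (g w) \<le> d" for g :: "'w \<Rightarrow> complex" and d
  proof (cases "integrable M g")
    case True
    have "cmod (LINT w|M. g w) \<le> (LINT w|M. cmod (g w))" by (rule integral_norm_bound)
    also have "\<dots> \<le> (LINT w|M. d)" using that True by (intro integral_mono) auto
    finally show ?thesis by (simp add: prob_space)
  next
    case False
    obtain w where "w \<in> space M" using not_empty by blast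
    with False that[of w] show ?thesis
      by (simp add: not_integrable_integral_eq order_trans[OF norm_ge_zero])
  qed
  have step: "cmod (a \<theta> (Suc t) - of_real (1 - \<theta>\<^sup>2 * c / 2) * a \<theta> t)
      \<le> \<bar>\<theta>\<bar> ^ 3 * D + \<theta> ^ 4 * (\<bar>c\<bar> * W / 4)" for \<theta> t
  proof -
    define K where "K r v = iexp (\<theta> * (additive_functional f t r + f (r t) v)) * \<phi> \<theta> v" for r v
    have K_past: "determined_by t (\<lambda>r. K r v)" for v
      unfolding K_def
      by (rule determined_by_additive_functional[of t "\<lambda>x u. iexp (\<theta> * (x + f u v)) * \<phi> \<theta> v" f])
    have intK: "integrable M (\<lambda>w. \<Sum>v\<in>V. P (X t w) v *\<^sub>R K (\<lambda>j. X j w) v)"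
      by (rule integrable_path_functional[OF determined_by_average[OF K_past]])
    have "a \<theta> (Suc t) = (LINT w|M. K (\<lambda>j. X j w) (X (Suc t) w))"
      by (simp add: a_def S_def K_def additive_functional_Suc)
    also have "\<dots> = (LINT w|M. (\<Sum>v\<in>V. P (X t w) v *\<^sub>R K (\<lambda>j. X j w) v))"
      by (rule markov_step) (rule K_past)
    finally have "a \<theta> (Suc t) - of_real (1 - \<theta>\<^sup>2 * c / 2) * a \<theta> t
        = (LINT w|M. (\<Sum>v\<in>V. P (X t w) v *\<^sub>R K (\<lambda>j. X j w) v)
             - of_real (1 - \<theta>\<^sup>2 * c / 2) * (iexp (\<theta> * S t w) * \<phi> \<theta> (X t w)))"
      using intK int_a by (simp add: a_def)
    also have "cmod \<dots> \<le> \<bar>\<theta>\<bar> ^ 3 * D + \<theta> ^ 4 * (\<bar>c\<bar> * W / 4)"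
    proof (rule const)
      fix w assume w: "w \<in> space M"
      define u where "u = X t w"
      have u: "u \<in> V" using w by (simp add: u_def)
      \<comment> \<open>The exponent \<open>f u v + h v\<close> equals \<open>m u v + h u\<close>.
        The factor \<open>iexp (\<theta> * (S t w + h u))\<close> therefore leaves the sum over
        \<open>v\<close>; it also divides the eigenvalue term and has modulus 1, so the path drops
        out of the estimate.\<close>
      have K: "K (\<lambda>j. X j w) v = iexp (\<theta> * (S t w + h u))
          * (iexp (\<theta> * m u v) * of_real (1 - \<theta>\<^sup>2 * z v / 2))" for v
        by (simp add: K_def \<phi>_def S_def u_def m_def exp_add[symmetric] algebra_simps)
      have "(\<Sum>v\<in>V. P u v *\<^sub>R K (\<lambda>j. X j w) v)
             - of_real (1 - \<theta>\<^sup>2 * c / 2) * (iexp (\<theta> * S t w) * \<phi> \<theta> u)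
          = iexp (\<theta> * (S t w + h u))
            * ((\<Sum>v\<in>V. of_real (P u v) * (iexp (\<theta> * m u v) * of_real (1 - \<theta>\<^sup>2 * z v / 2)))
               - of_real ((1 - \<theta>\<^sup>2 * c / 2) * (1 - \<theta>\<^sup>2 * z u / 2)))"
        unfolding right_diff_distrib sum_distrib_left K scaleR_conv_of_real
        by (simp add: \<phi>_def exp_add distrib_left mult_ac, simp add: field_simps)
      also have "cmod \<dots> = cmod ((\<Sum>v\<in>V. of_real (P u v) * (iexp (\<theta> * m u v) * of_real (1 - \<theta>\<^sup>2 * z v / 2)))
               - of_real ((1 - \<theta>\<^sup>2 * c / 2) * (1 - \<theta>\<^sup>2 * z u / 2)))"
        by (simp only: norm_mult norm_exp_i_times mult_1)
      also have "\<dots> \<le> \<bar>\<theta>\<bar> ^ 3 * D + \<theta> ^ 4 * (\<bar>c\<bar> * W / 4)"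
        unfolding D_def using u B W h[OF u] z[OF u] P_nonneg P_sum
        by (intro perturbed_kernel_expansion finite_states) (auto simp: m_def)
      finally show "cmod ((\<Sum>v\<in>V. P (X t w) v *\<^sub>R K (\<lambda>j. X j w) v)
             - of_real (1 - \<theta>\<^sup>2 * c / 2) * (iexp (\<theta> * S t w) * \<phi> \<theta> (X t w)))
           \<le> \<bar>\<theta>\<bar> ^ 3 * D + \<theta> ^ 4 * (\<bar>c\<bar> * W / 4)" by (simp only: u_def)
    qed
    finally show ?thesis .
  qed
  have a_near: "cmod (a \<theta> t - (LINT w|M. iexp (\<theta> * S t w))) \<le> \<bar>\<theta>\<bar> * H + \<theta>\<^sup>2 * W / 2" for \<theta> t
  proof -
    have "a \<theta> t - (LINT w|M. iexp (\<theta> * S t w)) = (LINT w|M. iexp (\<theta> * S t w) * (\<phi> \<theta> (X t w) - 1))"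
      using int_a int_e by (simp add: a_def right_diff_distrib)
    also have "cmod \<dots> \<le> \<bar>\<theta>\<bar> * H + \<theta>\<^sup>2 * W / 2"
      using \<phi>_near by (intro const) (simp add: norm_mult)
    finally show ?thesis .
  qed
  \<comment> \<open>This scaling makes the n-th power of the eigenvalue
    \<open>(1 - c / (2 n)) ^ n\<close>, with limit \<open>exp (- c / 2)\<close>, while n errors of
    order \<theta>^3 tend to 0. At \<open>n = 0\<close> the value is 0 by convention.\<close>
  define \<theta> where "\<theta> n = 1 / sqrt (real n)" for n
  define l where "l n = 1 - (\<theta> n)\<^sup>2 * c / 2" for n
  define E where "E n = (LINT w|M. iexp (\<theta> n * S n w))" for n
  have \<theta>0: "\<theta> \<longlonglongrightarrow> 0" unfolding \<theta>_def by real_asymp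
  have near0: "(\<lambda>n. \<bar>\<theta> n\<bar> * H + (\<theta> n)\<^sup>2 * W / 2) \<longlonglongrightarrow> 0"
    using \<theta>0 by (auto intro!: tendsto_eq_intros)
  have l_eq: "l n = 1 + (- c / 2) / real n" for n
    by (simp add: l_def \<theta>_def power_divide)
  have lpow: "(\<lambda>n. l n ^ n) \<longlonglongrightarrow> exp (- c / 2)"
    unfolding l_eq by (rule tendsto_exp_limit_sequentially)
  have "l \<longlonglongrightarrow> 1" unfolding l_def using \<theta>0 by (auto intro!: tendsto_eq_intros)
  \<comment> \<open>The initial law enters through this term. At time 0 the additive functional is
    0, and \<open>\<phi> (\<theta> n)\<close> tends to 1 uniformly, so the limit is 1 whatever the
    law of \<open>X 0\<close>.\<close>
  have a0: "(\<lambda>n. a (\<theta> n) 0) \<longlonglongrightarrow> 1"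
  proof -
    have "(\<lambda>n. a (\<theta> n) 0 - 1) \<longlonglongrightarrow> 0"
    proof (rule Lim_null_comparison[OF _ near0], rule always_eventually, rule allI)
      fix n
      have "(LINT w|M. iexp (\<theta> n * S 0 w)) = 1"
        by (simp add: S_def additive_functional_def prob_space)
      with a_near[of "\<theta> n" 0] show "cmod (a (\<theta> n) 0 - 1) \<le> \<bar>\<theta> n\<bar> * H + (\<theta> n)\<^sup>2 * W / 2" by simp
    qed
    then show ?thesis by (simp add: LIM_zero_iff)
  qed
  have an: "(\<lambda>n. a (\<theta> n) n - of_real (l n) ^ n * a (\<theta> n) 0) \<longlonglongrightarrow> 0"
  proof (rule Lim_null_comparison)
    show "(\<lambda>n. real n * (\<bar>\<theta> n\<bar> ^ 3 * D + (\<theta> n) ^ 4 * (\<bar>c\<bar> * W / 4))) \<longlonglongrightarrow> 0"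
      unfolding \<theta>_def by real_asymp
    \<comment> \<open>For small \<open>n\<close> and large \<open>c\<close> the eigenvalue may lie
      below -1, so the geometric comparison is made only eventually.\<close>
    have "\<forall>\<^sub>F n in sequentially. - 1 < l n"
      using \<open>l \<longlonglongrightarrow> 1\<close> by (rule order_tendstoD) simp
    moreover have "l n \<le> 1" for n using \<open>0 \<le> c\<close> by (simp add: l_def)
    ultimately have "\<forall>\<^sub>F n in sequentially. \<bar>l n\<bar> \<le> 1"
      by (auto elim!: eventually_mono simp: abs_le_iff)
    then show "\<forall>\<^sub>F n in sequentially. cmod (a (\<theta> n) n - of_real (l n) ^ n * a (\<theta> n) 0)
        \<le> real n * (\<bar>\<theta> n\<bar> ^ 3 * D + (\<theta> n) ^ 4 * (\<bar>c\<bar> * W / 4))"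
      by eventually_elim (rule approximate_geometric, unfold l_def, rule step)
  qed
  have "(\<lambda>n. a (\<theta> n) n) \<longlonglongrightarrow> of_real (exp (- c / 2))"
  proof -
    have "(\<lambda>n. of_real (l n ^ n) * a (\<theta> n) 0) \<longlonglongrightarrow> of_real (exp (- c / 2)) * 1"
      by (intro tendsto_mult tendsto_of_real lpow a0)
    from tendsto_add[OF an this] show ?thesis by simp
  qed
  moreover have "(\<lambda>n. a (\<theta> n) n - E n) \<longlonglongrightarrow> 0"
    using a_near by (intro Lim_null_comparison[OF _ near0] always_eventually) (auto simp: E_def)
  ultimately have "E \<longlonglongrightarrow> of_real (exp (- c / 2))"
    using tendsto_diff by fastforce
  then show ?thesis by (simp add: E_def[abs_def] S_def \<theta>_def)
qed

text \<open>Adding \<open>h\<close> at the current state turns the functional into a martingale with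
  increments bounded by \<open>B\<close>. The cross term of the square averages to 0, so the second
  moment grows by at most B^2 per step. The result supplies the tightness of the rescaled
  laws.\<close>

lemma additive_functional_second_moment:
  assumes h: "\<And>u. u \<in> V \<Longrightarrow> (\<Sum>v\<in>V. P u v * (f u v + h v - h u)) = 0"
  shows "\<exists>C. \<forall>n. (LINT w|M. (additive_functional f n (\<lambda>j. X j w) / sqrt (real n))\<^sup>2) \<le> C"
proof -
  define m where "m u v = f u v + h v - h u" for u v
  obtain B H where B: "\<And>u v. u \<in> V \<Longrightarrow> v \<in> V \<Longrightarrow> \<bar>m u v\<bar> \<le> B"
    and H: "\<And>v. v \<in> V \<Longrightarrow> \<bar>h v\<bar> \<le> H"
    using pairs_bound[of m] states_bound[of h] by metis
  define S where "S t w = additive_functional f t (\<lambda>j. X j w)" for t w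
  have int: "integrable M (\<lambda>w. F (S t w) (X t w))" for F :: "real \<Rightarrow> 'a \<Rightarrow> real" and t
    unfolding S_def
    by (rule integrable_path_functional[OF determined_by_additive_functional[of t F f]])
  have martingale: "(LINT w|M. (S t w + h (X t w))\<^sup>2) \<le> H\<^sup>2 + B\<^sup>2 * real t" for t
  proof (induction t)
    case 0
    have "(LINT w|M. (S 0 w + h (X 0 w))\<^sup>2) \<le> (LINT w|M. H\<^sup>2)"
      using H by (intro integral_mono int[of "\<lambda>x v. (x + h v)\<^sup>2"])
        (auto simp: S_def additive_functional_def intro!: abs_le_square_iff[THEN iffD1] order_trans[OF _ abs_ge_self])
    then show ?case by (simp add: prob_space)
  next
    case (Suc t)
    define K where "K r v = (additive_functional f t r + f (r t) v + h v)\<^sup>2" for r v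
    have K_past: "determined_by t (\<lambda>r. K r v)" for v
      unfolding K_def
      by (rule determined_by_additive_functional[of t "\<lambda>x u. (x + f u v + h v)\<^sup>2" f])
    have "(LINT w|M. (S (Suc t) w + h (X (Suc t) w))\<^sup>2) = (LINT w|M. K (\<lambda>j. X j w) (X (Suc t) w))"
      by (simp add: S_def K_def additive_functional_Suc)
    also have "\<dots> = (LINT w|M. (\<Sum>v\<in>V. P (X t w) v *\<^sub>R K (\<lambda>j. X j w) v))"
      by (rule markov_step) (rule K_past)
    also have "\<dots> \<le> (LINT w|M. (S t w + h (X t w))\<^sup>2 + B\<^sup>2)"
    proof (rule integral_mono)
      show "integrable M (\<lambda>w. \<Sum>v\<in>V. P (X t w) v *\<^sub>R K (\<lambda>j. X j w) v)"
        by (rule integrable_path_functional[OF determined_by_average[OF K_past]])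
      show "integrable M (\<lambda>w. (S t w + h (X t w))\<^sup>2 + B\<^sup>2)"
        by (rule int[of "\<lambda>x v. (x + h v)\<^sup>2 + B\<^sup>2"])
      fix w assume w: "w \<in> space M"
      define u where "u = X t w"
      define y where "y = S t w + h u"
      have u: "u \<in> V" using w by (simp add: u_def)
      have "(\<Sum>v\<in>V. P u v *\<^sub>R K (\<lambda>j. X j w) v)
          = (\<Sum>v\<in>V. y\<^sup>2 * P u v + 2 * y * (P u v * m u v) + P u v * (m u v)\<^sup>2)"
        by (intro sum.cong refl)
          (simp add: K_def y_def m_def u_def S_def power2_eq_square algebra_simps)
      also have "\<dots> = y\<^sup>2 + (\<Sum>v\<in>V. P u v * (m u v)\<^sup>2)"
        using h[OF u] P_sum[OF u] by (simp add: sum.distrib m_def flip: sum_distrib_left)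
      also have "(\<Sum>v\<in>V. P u v * (m u v)\<^sup>2) \<le> (\<Sum>v\<in>V. P u v * B\<^sup>2)"
        using P_nonneg[OF u] B[OF u]
        by (intro sum_mono mult_left_mono) (auto intro!: abs_le_square_iff[THEN iffD1] order_trans[OF _ abs_ge_self])
      also have "\<dots> = B\<^sup>2" by (simp add: P_sum[OF u] flip: sum_distrib_right)
      finally show "(\<Sum>v\<in>V. P (X t w) v *\<^sub>R K (\<lambda>j. X j w) v) \<le> (S t w + h (X t w))\<^sup>2 + B\<^sup>2"
        by (simp add: u_def y_def)
    qed
    also have "\<dots> = (LINT w|M. (S t w + h (X t w))\<^sup>2) + B\<^sup>2"
      by (subst Bochner_Integration.integral_add)
        (auto intro: int[of "\<lambda>x v. (x + h v)\<^sup>2"] simp: prob_space)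
    finally show ?case using Suc by (simp add: algebra_simps)
  qed
  \<comment> \<open>From S^2 <= 2 (S + h)^2 + 2 h^2 and the martingale bound H^2 + B^2 n one gets 4
    H^2 + 2 B^2 n, and 4 H^2 is at most 4 H^2 n once \<open>n\<close> is positive. At
    \<open>n = 0\<close> the integrand is 0.\<close>
  have "(LINT w|M. (S n w / sqrt (real n))\<^sup>2) \<le> 4 * H\<^sup>2 + 2 * B\<^sup>2" for n
  proof (cases "n = 0")
    case False
    have "(LINT w|M. (S n w)\<^sup>2) \<le> (LINT w|M. 2 * (S n w + h (X n w))\<^sup>2 + 2 * H\<^sup>2)"
    proof (rule integral_mono)
      show "integrable M (\<lambda>w. (S n w)\<^sup>2)" by (rule int[of "\<lambda>x v. x\<^sup>2"])
      show "integrable M (\<lambda>w. 2 * (S n w + h (X n w))\<^sup>2 + 2 * H\<^sup>2)"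
        by (rule int[of "\<lambda>x v. 2 * (x + h v)\<^sup>2 + 2 * H\<^sup>2"])
      fix w assume "w \<in> space M"
      then have "(h (X n w))\<^sup>2 \<le> H\<^sup>2"
        using H[of "X n w"] by (auto intro!: abs_le_square_iff[THEN iffD1] order_trans[OF _ abs_ge_self])
      moreover have "(S n w)\<^sup>2 \<le> 2 * (S n w + h (X n w))\<^sup>2 + 2 * (h (X n w))\<^sup>2"
        using zero_le_power2[of "S n w + 2 * h (X n w)"] by (simp add: power2_eq_square algebra_simps)
      ultimately show "(S n w)\<^sup>2 \<le> 2 * (S n w + h (X n w))\<^sup>2 + 2 * H\<^sup>2" by linarith
    qed
    also have "\<dots> = 2 * (LINT w|M. (S n w + h (X n w))\<^sup>2) + 2 * H\<^sup>2"
      by (subst Bochner_Integration.integral_add)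
        (auto intro: int[of "\<lambda>x v. (x + h v)\<^sup>2"] simp: prob_space)
    also have "\<dots> \<le> 4 * H\<^sup>2 + 2 * B\<^sup>2 * real n" using martingale[of n] by simp
    also have "\<dots> \<le> (4 * H\<^sup>2 + 2 * B\<^sup>2) * real n"
      using False mult_left_mono[of 1 "real n" "4 * H\<^sup>2"] by (simp add: distrib_right)
    finally show ?thesis using False by (simp add: power_divide field_simps)
  qed (simp add: S_def additive_functional_def)
  then show ?thesis by (auto simp: S_def)
qed

end

section \<open>Weak convergence of random vectors\<close>

abbreviation pairing :: "nat \<Rightarrow> (nat \<Rightarrow> real) \<Rightarrow> (nat \<Rightarrow> real) \<Rightarrow> real" where
  "pairing g a z \<equiv> \<Sum>i<g. a i * z i"

text \<open>The phase \<open>b\<close> covers sines as well, so sums of these real functions are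
  closed under products by the product-to-sum formula. Frequencies are arbitrary reals: cosines of
  linear forms are exactly what characteristic functions control, and rescaled ones separate points
  of any cube.\<close>

inductive trig_poly :: "nat \<Rightarrow> ((nat \<Rightarrow> real) \<Rightarrow> real) \<Rightarrow> bool" for g where
  cos: "trig_poly g (\<lambda>z. c * cos (pairing g a z + b))"
| add: "trig_poly g F \<Longrightarrow> trig_poly g H \<Longrightarrow> trig_poly g (\<lambda>z. F z + H z)"

lemma trig_poly_const: "trig_poly g (\<lambda>_. c)"
  using trig_poly.cos[of g c "\<lambda>_. 0" 0] by simp

lemma trig_poly_mult:
  assumes "trig_poly g F" "trig_poly g H"
  shows "trig_poly g (\<lambda>z. F z * H z)"
  using assms
proof (induction arbitrary: H)
  case (cos c a b)
  from cos show ?case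
  proof induction
    case (cos c' a' b')
    have "trig_poly g (\<lambda>z. c * c' / 2 * cos (pairing g (\<lambda>i. a i - a' i) z + (b - b'))
        + c * c' / 2 * cos (pairing g (\<lambda>i. a i + a' i) z + (b + b')))"
      by (intro trig_poly.intros)
    also have "(\<lambda>z. c * c' / 2 * cos (pairing g (\<lambda>i. a i - a' i) z + (b - b'))
        + c * c' / 2 * cos (pairing g (\<lambda>i. a i + a' i) z + (b + b')))
      = (\<lambda>z. (c * cos (pairing g a z + b)) * (c' * cos (pairing g a' z + b')))"
    proof
      fix z
      have "pairing g (\<lambda>i. a i - a' i) z + (b - b') = (pairing g a z + b) - (pairing g a' z + b')"
        "pairing g (\<lambda>i. a i + a' i) z + (b + b') = (pairing g a z + b) + (pairing g a' z + b')"
        by (simp_all add: left_diff_distrib distrib_right sum.distrib sum_subtractf)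
      moreover have "c * c' / 2 * cos (x - y) + c * c' / 2 * cos (x + y) = (c * cos x) * (c' * cos y)"
        for x y :: real by (simp add: cos_diff cos_add algebra_simps)
      ultimately show "c * c' / 2 * cos (pairing g (\<lambda>i. a i - a' i) z + (b - b'))
          + c * c' / 2 * cos (pairing g (\<lambda>i. a i + a' i) z + (b + b'))
        = (c * cos (pairing g a z + b)) * (c' * cos (pairing g a' z + b'))" by (simp only:)
    qed
    finally show ?case .
  next
    case (add F H)
    then show ?case by (simp add: distrib_left trig_poly.add)
  qed
next
  case (add F1 F2)
  then show ?case by (simp add: distrib_right trig_poly.add)
qed

lemma trig_poly_continuous:
  assumes "trig_poly g F" shows "continuous_on UNIV F"
  using assms
proof induction
  case (cos c a b)
  have "continuous_on UNIV (\<lambda>z::nat \<Rightarrow> real. z i)" for i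
    by (rule continuous_on_product_coordinates)
  then show ?case by (intro continuous_intros) 
qed (intro continuous_intros)

lemma trig_poly_bounded:
  assumes "trig_poly g F" shows "\<exists>R. \<forall>z. \<bar>F z\<bar> \<le> R"
  using assms
proof induction
  case (cos c a b)
  show ?case
    by (rule exI[of _ "\<bar>c\<bar>"]) (auto simp: abs_mult intro: mult_left_le)
next
  case (add F H)
  then obtain R R' where "\<forall>z. \<bar>F z\<bar> \<le> R" "\<forall>z. \<bar>H z\<bar> \<le> R'" by blast
  then show ?case
    by (intro exI[of _ "R + R'"]) (metis abs_triangle_ineq add_mono order_trans)
qed

lemma trig_poly_measurable:
  assumes "trig_poly g F" shows "F \<in> borel_measurable (vec_borel g)"
  using assms
proof induction
  case (cos c a b)
  have [measurable]: "(\<lambda>z. z i) \<in> borel_measurable (vec_borel g)" if "i < g" for i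
    using that by (intro measurable_component_singleton) auto
  have "(\<lambda>z. pairing g a z) \<in> borel_measurable (vec_borel g)"
    by (intro borel_measurable_sum borel_measurable_times) auto
  then show ?case by measurable
qed measurable

lemma trig_poly_polynomial:
  assumes "real_polynomial_function (q :: real \<Rightarrow> real)" "trig_poly g F"
  shows "trig_poly g (\<lambda>z. q (F z))"
  using assms(1)
proof induction
  case (linear f)
  then obtain c where "f = (\<lambda>x. x * c)" using real_bounded_linear by blast
  then show ?case using trig_poly_mult[OF assms(2) trig_poly_const] by simp
next
  case (const c)
  show ?case by (rule trig_poly_const)
qed (auto intro: trig_poly.add trig_poly_mult)

text \<open>Extensional vectors form a topological subspace, not a type. Precomposing with
  restriction carries \<open>f\<close> to the full function space, where results about type-class
  topologies apply.\<close>

lemma continuous_map_vec_extend: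
  assumes "continuous_map (vec_topology g) euclideanreal f"
  shows "continuous_on UNIV (\<lambda>z. f (restrict z {..<g}))"
proof -
  have "continuous_map euclidean (vec_topology g) (\<lambda>z. restrict z {..<g})"
    unfolding continuous_map_componentwise using continuous_on_product_coordinates by auto
  from continuous_map_compose[OF this assms] show ?thesis by (simp add: comp_def)
qed

text \<open>Extensional vectors embed measurably into all real sequences, where the countable
  product sigma-algebra is the Borel one. The coordinates from \<open>g\<close> on are constantly
  \<open>undefined\<close> and so cause no harm.\<close>

lemma continuous_map_vec_measurable:
  assumes "continuous_map (vec_topology g) euclideanreal f"
  shows "f \<in> borel_measurable (vec_borel g)"
proof -
  have "(\<lambda>z. f (restrict z {..<g})) \<in> borel_measurable (borel :: (nat \<Rightarrow> real) measure)"
    by (rule borel_measurable_continuous_onI[OF continuous_map_vec_extend[OF assms]])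
  moreover have "(\<lambda>z. z) \<in> measurable (vec_borel g) (PiM UNIV (\<lambda>_. borel))"
  proof (rule measurable_PiM_single')
    fix i :: nat
    show "(\<lambda>z. z i) \<in> borel_measurable (vec_borel g)"
    proof (cases "i < g")
      case False
      then have "(\<lambda>z. undefined :: real) \<in> borel_measurable (vec_borel g) \<longleftrightarrow> ?thesis"
        by (intro measurable_cong) (auto simp: space_PiM PiE_def extensional_def)
      then show ?thesis by simp
    qed (auto intro: measurable_component_singleton)
  qed (auto simp: space_PiM)
  then have "(\<lambda>z. z) \<in> measurable (vec_borel g) borel"
    by (simp add: measurable_cong_sets[OF refl sets_PiM_equal_borel])
  ultimately have "(\<lambda>z. f (restrict z {..<g})) \<in> borel_measurable (vec_borel g)"
    by (rule measurable_compose[rotated])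
  also have "?this \<longleftrightarrow> ?thesis"
    by (intro measurable_cong) (auto simp: space_PiM PiE_def extensional_restrict)
  finally show ?thesis .
qed

text \<open>
  Stone-Weierstrass controls the approximant only on a cube. Composing it with a polynomial close
  to the clamping function keeps it a trigonometric polynomial and makes it bounded everywhere by
  essentially the bound of the function approximated.
\<close>

lemma trig_poly_approximation:
  assumes f: "continuous_map (vec_topology g) euclideanreal f"
    and B: "\<And>z. z \<in> extensional {..<g} \<Longrightarrow> \<bar>f z\<bar> \<le> B" and e: "0 < e" and K: "0 < K"
  shows "\<exists>F. trig_poly g F \<and>
    (\<forall>z\<in>extensional {..<g}. \<bar>f z - F z\<bar> \<le> e + 2 * B * (\<Sum>i<g. (z i)\<^sup>2) / K\<^sup>2)"
proof -
  \<comment> \<open>The cube of half-width \<open>K\<close>, placed in the full function space by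
    pinning the remaining coordinates to \<open>undefined\<close>; it is then compact by
    Tychonoff.\<close>
  define C where "C = PiE UNIV (\<lambda>i. if i < g then {- K..K} else {undefined::real})"
  have C_ext: "z \<in> extensional {..<g}" if "z \<in> C" for z
  unfolding extensional_def
  proof (intro CollectI allI impI)
    fix i assume "i \<notin> {..<g}"
    then show "z i = undefined" using PiE_mem[OF that[unfolded C_def], of i] by simp
  qed
  have B0: "0 \<le> B" using B[of "restrict (\<lambda>_. 0) {..<g}"] by force
  have "compactin (product_topology (\<lambda>_. euclidean) UNIV) C"
    unfolding C_def compactin_PiE by auto
  then have "compact C" by (simp add: euclidean_product_topology)
  have "continuous_on C (\<lambda>z. f (restrict z {..<g}))"
    using continuous_map_vec_extend[OF f] continuous_on_subset by blast
  then have "continuous_on C f"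
    by (rule continuous_on_eq) (use C_ext in \<open>auto simp: extensional_restrict\<close>)
  have sep: "\<exists>F. trig_poly g F \<and> F z \<noteq> F z'" if "z \<in> C" "z' \<in> C" "z \<noteq> z'" for z z'
  proof -
    have "\<exists>i\<in>{..<g}. z i \<noteq> z' i"
      using extensionalityI[OF C_ext[OF that(1)] C_ext[OF that(2)]] that(3) by blast
    then obtain i where i: "i < g" "z i \<noteq> z' i" by blast
    \<comment> \<open>The scale brings both coordinates into (-1, 1), where the sine is injective.
      The phase \<open>- (pi / 2)\<close> below turns the cosine into that sine.\<close>
    define s where "s = 1 / (\<bar>z i\<bar> + \<bar>z' i\<bar> + 1)"
    have s: "0 < s" by (simp add: s_def add_nonneg_pos)
    have small: "\<bar>s * z i\<bar> < pi / 2" "\<bar>s * z' i\<bar> < pi / 2"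
    proof -
      have "\<bar>s * z i\<bar> < 1" "\<bar>s * z' i\<bar> < 1"
        by (auto simp: s_def abs_mult field_simps)
      then show "\<bar>s * z i\<bar> < pi / 2" "\<bar>s * z' i\<bar> < pi / 2" using pi_ge_two by linarith+
    qed
    define F where "F z = 1 * cos (pairing g (\<lambda>j. if j = i then s else 0) z + (- (pi / 2)))" for z
    have F: "F z = sin (s * z i)" for z
    proof -
      have "pairing g (\<lambda>j. if j = i then s else 0) z = s * z i"
        using i(1) by (simp add: if_distrib[where f = "\<lambda>c. c * _"] sum.delta cong: if_cong)
      then show ?thesis by (simp add: F_def cos_diff)
    qed
    have "sin (s * z i) \<noteq> sin (s * z' i)"
    proof
      assume eq: "sin (s * z i) = sin (s * z' i)"
      have "s * z i = s * z' i"
        by (rule sin_inj_pi[OF _ _ _ _ eq]) (use small in \<open>simp_all add: abs_less_iff\<close>)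
      with s i(2) show False by simp
    qed
    then have "F z \<noteq> F z'" by (simp add: F)
    moreover have "trig_poly g F" unfolding F_def by (rule trig_poly.cos)
    ultimately show ?thesis by blast
  qed
  have "\<exists>Q. trig_poly g Q \<and> (\<forall>z\<in>C. \<bar>f z - Q z\<bar> < e / 3)"
  proof (rule Stone_Weierstrass_HOL[OF \<open>compact C\<close>])
    show "continuous_on C F" if "trig_poly g F" for F
      using continuous_on_subset[OF trig_poly_continuous[OF that]] by simp
    show "trig_poly g (\<lambda>x. F x + H x)" if "trig_poly g F \<and> trig_poly g H" for F H
      using that by (blast intro: trig_poly.add)
    show "trig_poly g (\<lambda>x. F x * H x)" if "trig_poly g F \<and> trig_poly g H" for F H
      using that by (blast intro: trig_poly_mult)
    show "\<exists>F. trig_poly g F \<and> F x \<noteq> F y" if "x \<in> C \<and> y \<in> C \<and> x \<noteq> y" for x y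
      using that sep by blast
  qed (use e \<open>continuous_on C f\<close> trig_poly_const in simp_all)
  then obtain Q where Q: "trig_poly g Q" and Q_near: "\<And>z. z \<in> C \<Longrightarrow> \<bar>f z - Q z\<bar> < e / 3"
    by blast
  obtain R where R: "\<And>z. \<bar>Q z\<bar> \<le> R" using trig_poly_bounded[OF Q] by blast
  define \<psi> where "\<psi> s = max (- B) (min B s)" for s :: real
  have "continuous_on {- R..R} \<psi>" unfolding \<psi>_def by (intro continuous_intros)
  then obtain q where q: "real_polynomial_function q"
    and q_near: "\<And>s. s \<in> {- R..R} \<Longrightarrow> \<bar>\<psi> s - q s\<bar> < e / 3"
    using Stone_Weierstrass_real_polynomial_function[of "{- R..R}" \<psi> "e / 3"] e by auto
  have qQ: "\<bar>\<psi> (Q z) - q (Q z)\<bar> < e / 3" for z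
    using R[of z] by (intro q_near) (simp add: abs_le_iff)
  \<comment> \<open>On the cube clamping cannot increase the distance to \<open>f\<close>, which
    already lies in \<open>[-B, B]\<close>. Off the cube some coordinate exceeds \<open>K\<close> in
    modulus, so the quadratic term is at least \<open>2 * B\<close> and pays for both functions;
    integrated, this is Chebyshev's bound.\<close>
  have "\<bar>f z - q (Q z)\<bar> \<le> e + 2 * B * (\<Sum>i<g. (z i)\<^sup>2) / K\<^sup>2" if z: "z \<in> extensional {..<g}" for z
  proof (cases "z \<in> C")
    case True
    have "\<bar>f z - \<psi> (Q z)\<bar> \<le> \<bar>f z - Q z\<bar>" using B[OF z] by (auto simp: \<psi>_def)
    with Q_near[OF True] qQ[of z] e have "\<bar>f z - q (Q z)\<bar> \<le> e" by linarith
    moreover have "0 \<le> 2 * B * (\<Sum>i<g. (z i)\<^sup>2) / K\<^sup>2"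
      using B0 by (intro divide_nonneg_nonneg mult_nonneg_nonneg sum_nonneg) auto
    ultimately show ?thesis by linarith
  next
    case False
    have "z \<in> C" if "\<And>i. i < g \<Longrightarrow> \<bar>z i\<bar> \<le> K"
      unfolding C_def
    proof (rule PiE_I)
      show "z i \<in> (if i < g then {- K..K} else {undefined})" for i
        using that[of i] extensional_arb[OF z, of i] by (auto simp: abs_le_iff)
    qed simp
    with False obtain i where i: "i < g" "\<not> \<bar>z i\<bar> \<le> K" by blast
    then have "K\<^sup>2 \<le> (z i)\<^sup>2" using K by (simp add: abs_le_square_iff[symmetric])
    also have "\<dots> \<le> (\<Sum>i<g. (z i)\<^sup>2)" using i by (intro member_le_sum) auto
    finally have "2 * B * 1 \<le> 2 * B * ((\<Sum>i<g. (z i)\<^sup>2) / K\<^sup>2)"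
      using B0 K by (intro mult_left_mono) auto
    then have "2 * B \<le> 2 * B * (\<Sum>i<g. (z i)\<^sup>2) / K\<^sup>2" by simp
    moreover have "\<bar>\<psi> (Q z)\<bar> \<le> B" using B0 by (auto simp: \<psi>_def)
    ultimately show ?thesis using B[OF z] qQ[of z] e by linarith
  qed
  then show ?thesis using trig_poly_polynomial[OF q Q] by blast
qed

text \<open>The common second-moment bound makes the approximation of \<open>f\<close> by one
  trigonometric polynomial uniform over all the laws and the limit. Convergence for that polynomial
  is linear in the cosine hypothesis.\<close>

lemma weakly_converges_vecI:
  assumes L: "\<And>n. prob_space (L n)" "\<And>n. sets (L n) = sets (vec_borel g)"
    and N: "prob_space N" "sets N = sets (vec_borel g)"
    and cos: "\<And>a b. (\<lambda>n. LINT z|L n. cos (pairing g a z + b)) \<longlonglongrightarrow> (LINT z|N. cos (pairing g a z + b))"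
    and L2: "\<And>n. integrable (L n) (\<lambda>z. \<Sum>i<g. (z i)\<^sup>2)" "\<And>n. (LINT z|L n. (\<Sum>i<g. (z i)\<^sup>2)) \<le> D"
    and N2: "integrable N (\<lambda>z. \<Sum>i<g. (z i)\<^sup>2)" "(LINT z|N. (\<Sum>i<g. (z i)\<^sup>2)) \<le> D"
  shows "weakly_converges (vec_topology g) L N"
  unfolding weakly_converges_def
proof (intro allI impI, elim conjE)
  fix f assume f: "continuous_map (vec_topology g) euclideanreal f"
    and bdd: "bounded (f ` topspace (vec_topology g))"
  have top: "topspace (vec_topology g) = extensional {..<g}" by (simp add: PiE_def)
  obtain B where B: "\<And>z. z \<in> extensional {..<g} \<Longrightarrow> \<bar>f z\<bar> \<le> B"
    using bdd unfolding top bounded_real by blast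
  have B0: "0 \<le> B" using B[of "restrict (\<lambda>_. 0) {..<g}"] by force
  have D0: "0 \<le> D"
    using N2(2) by (rule order_trans[rotated]) (auto intro!: Bochner_Integration.integral_nonneg sum_nonneg)
  have spaces: "space Q = extensional {..<g}" if "sets Q = sets (vec_borel g)" for Q
    using sets_eq_imp_space_eq[OF that] by (simp add: space_PiM PiE_def)
  have int_f: "integrable Q f" if "prob_space Q" "sets Q = sets (vec_borel g)" for Q
  proof -
    interpret prob_space Q by fact
    show ?thesis
      using continuous_map_vec_measurable[OF f] B spaces[OF that(2)] that(2)
      by (intro integrable_const_bound[of _ B]) (auto cong: measurable_cong_sets)
  qed
  have int_F: "integrable Q F" if "prob_space Q" "sets Q = sets (vec_borel g)" and F: "trig_poly g F" for Q F
  proof -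
    interpret prob_space Q by fact
    obtain R where "\<And>z. \<bar>F z\<bar> \<le> R" using trig_poly_bounded[OF F] by blast
    then show ?thesis
      using trig_poly_measurable[OF F] that(2)
      by (intro integrable_const_bound[of _ R]) (auto cong: measurable_cong_sets)
  qed
  have trig: "(\<lambda>n. LINT z|L n. F z) \<longlonglongrightarrow> (LINT z|N. F z)" if "trig_poly g F" for F
    using that
  proof induction
    case (cos c a b)
    show ?case using tendsto_mult_left[OF assms(5)] by simp
  next
    case (add F H)
    then show ?case using int_F L N by (simp add: tendsto_add)
  qed
  show "(\<lambda>n. LINT z|L n. f z) \<longlonglongrightarrow> (LINT z|N. f z)"
  proof (rule LIMSEQ_I)
    fix e :: real assume e: "0 < e"
    \<comment> \<open>Chosen so that the quadratic error, of integral at most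
      \<open>2 * B * D / K\<^sup>2\<close>, costs at most \<open>e / 8\<close>. The summand 1 keeps
      \<open>K\<close> positive when \<open>B * D\<close> is 0.\<close>
    define K where "K = sqrt (16 * B * D / e + 1)"
    have K2: "K\<^sup>2 = 16 * B * D / e + 1" and K: "0 < K"
      using B0 D0 e by (auto simp: K_def add_nonneg_pos)
    have small: "2 * B * D / K\<^sup>2 \<le> e / 8"
    proof -
      have "2 * B * D \<le> e / 8 * K\<^sup>2" using e by (simp add: K2 field_simps)
      then show ?thesis using K by (simp add: pos_divide_le_eq)
    qed
    obtain F where F: "trig_poly g F"
      and near: "\<And>z. z \<in> extensional {..<g} \<Longrightarrow>
        \<bar>f z - F z\<bar> \<le> e / 8 + 2 * B * (\<Sum>i<g. (z i)\<^sup>2) / K\<^sup>2"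
      using trig_poly_approximation[OF f B, of "e / 8" K] e K by auto
    have near_int: "\<bar>(LINT z|Q. f z) - (LINT z|Q. F z)\<bar> \<le> e / 4"
      if Q: "prob_space Q" "sets Q = sets (vec_borel g)" "integrable Q (\<lambda>z. \<Sum>i<g. (z i)\<^sup>2)"
        "(LINT z|Q. (\<Sum>i<g. (z i)\<^sup>2)) \<le> D" for Q
    proof -
      interpret prob_space Q by fact
      note ints = int_f[OF Q(1,2)] int_F[OF Q(1,2) F]
      have "\<bar>(LINT z|Q. f z) - (LINT z|Q. F z)\<bar> = \<bar>LINT z|Q. f z - F z\<bar>"
        using ints by simp
      also have "\<dots> \<le> (LINT z|Q. \<bar>f z - F z\<bar>)" by (rule integral_abs_bound)
      also have "\<dots> \<le> (LINT z|Q. e / 8 + (\<Sum>i<g. (z i)\<^sup>2) * (2 * B / K\<^sup>2))"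
        using ints Q(3) near spaces[OF Q(2)]
        by (intro integral_mono integrable_abs Bochner_Integration.integrable_diff
              Bochner_Integration.integrable_add integrable_mult_left)
          (auto simp: mult.commute)
      also have "\<dots> = e / 8 + (LINT z|Q. (\<Sum>i<g. (z i)\<^sup>2)) * (2 * B / K\<^sup>2)"
        using Q(3) by (subst Bochner_Integration.integral_add) (auto simp: prob_space)
      also have "\<dots> \<le> e / 8 + D * (2 * B / K\<^sup>2)"
        using Q(4) B0 by (intro add_left_mono mult_right_mono) auto
      also have "\<dots> \<le> e / 4" using small by (simp add: mult.commute[of D])
      finally show ?thesis .
    qed
    from LIMSEQ_D[OF trig[OF F], of "e / 4"] e obtain n0
      where n0: "\<And>n. n0 \<le> n \<Longrightarrow> \<bar>(LINT z|L n. F z) - (LINT z|N. F z)\<bar> < e / 4"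
      by auto
    have "norm ((LINT z|L n. f z) - (LINT z|N. f z)) < e" if "n0 \<le> n" for n
      using n0[OF that] near_int[OF L(1,2) L2, of n] near_int[OF N N2] e
      unfolding real_norm_def by linarith
    then show "\<exists>n0. \<forall>n\<ge>n0. norm ((LINT z|L n. f z) - (LINT z|N. f z)) < e" by blast
  qed
qed

section \<open>Gaussian vectors\<close>

lemma std_normal_prob_space: "prob_space std_normal_distribution"
  using real_dist_normal_dist by (simp add: real_distribution_def)

text \<open>Scaling a standard normal variable treats the point mass and the densities alike, so
  characteristic function and moments follow without a case distinction.\<close>

lemma normal_law_eq_distr:
  assumes "0 \<le> v"
  shows "normal_law 0 v = distr std_normal_distribution borel (\<lambda>x. sqrt v * x)"
proof (cases "v = 0")
  case True
  interpret prob_space std_normal_distribution by (rule std_normal_prob_space)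
  show ?thesis using True by (simp add: normal_law_def distr_const)
next
  case False
  interpret prob_space std_normal_distribution by (rule std_normal_prob_space)
  have "distributed std_normal_distribution lborel (\<lambda>x. x) (normal_density 0 1)"
    by (auto simp: distributed_def distr_id2)
  from normal_density_affine[OF this, of "sqrt v" 0] assms False
  have "distributed std_normal_distribution lborel (\<lambda>x. sqrt v * x) (normal_density 0 (sqrt v))"
    by simp
  from distributed_distr_eq_density[OF this]
  have "distr std_normal_distribution lborel (\<lambda>x. sqrt v * x) = normal_law 0 v"
    using False by (simp add: normal_law_def)
  moreover have "distr std_normal_distribution lborel (\<lambda>x. sqrt v * x)
      = distr std_normal_distribution borel (\<lambda>x. sqrt v * x)"
    by (rule distr_cong) auto
  ultimately show ?thesis by simp
qed

lemma char_normal_law: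
  assumes "0 \<le> v" shows "char (normal_law 0 v) t = of_real (exp (- (v * t\<^sup>2) / 2))"
proof -
  have "char (normal_law 0 v) t = char std_normal_distribution (t * sqrt v)"
    by (simp add: normal_law_eq_distr[OF assms] char_def integral_distr mult.assoc)
  then show ?thesis
    using assms by (simp add: char_std_normal_distribution power_mult_distrib mult.commute)
qed

lemma normal_law_moments:
  assumes "0 \<le> v"
  shows "integrable (normal_law 0 v) (\<lambda>x. x)" "(LINT x|normal_law 0 v. x) = 0"
    and "integrable (normal_law 0 v) (\<lambda>x. x\<^sup>2)" "(LINT x|normal_law 0 v. x\<^sup>2) = v"
proof -
  have i1: "integrable std_normal_distribution (\<lambda>x. x)"
    using integrable_std_normal_distribution_moment[of 1] by simp
  have e1: "(LINT x|std_normal_distribution. x) = 0"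
    using integral_std_normal_distribution_moment_odd[of 1] by simp
  note i2 = integrable_std_normal_distribution_moment[of 2]
  have e2: "(LINT x|std_normal_distribution. x\<^sup>2) = 1"
    using std_normal_distribution_even_moments[of 1] by simp
  have meas: "(\<lambda>x. sqrt v * x) \<in> borel_measurable std_normal_distribution" by simp
  note eq = normal_law_eq_distr[OF assms]
  show "integrable (normal_law 0 v) (\<lambda>x. x)"
    unfolding eq by (subst integrable_distr_eq[OF meas]) (simp, rule integrable_mult_right, rule i1)
  show "(LINT x|normal_law 0 v. x) = 0"
    unfolding eq by (subst integral_distr[OF meas]) (simp, simp only: integral_mult_right_zero e1 mult_zero_right)
  have sq: "(sqrt v * x)\<^sup>2 = v * x\<^sup>2" for x using assms by (simp add: power_mult_distrib)
  show "integrable (normal_law 0 v) (\<lambda>x. x\<^sup>2)"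
    unfolding eq
    by (subst integrable_distr_eq[OF meas]) (simp, simp only: sq, rule integrable_mult_right, rule i2)
  show "(LINT x|normal_law 0 v. x\<^sup>2) = v"
    unfolding eq by (subst integral_distr[OF meas]) (simp, simp only: sq integral_mult_right_zero e2 mult_1_right)
qed

section \<open>Linear images of independent standard normals\<close>

lemma std_normal_component_measurable:
  assumes "e \<in> I"
  shows "(\<lambda>z. z e) \<in> borel_measurable (PiM I (\<lambda>_. std_normal_distribution))"
proof -
  have "(\<lambda>z. z e) \<in> measurable (PiM I (\<lambda>_. std_normal_distribution)) std_normal_distribution"
    using assms by (rule measurable_component_singleton)
  also have "measurable (PiM I (\<lambda>_. std_normal_distribution)) std_normal_distribution
      = borel_measurable (PiM I (\<lambda>_. std_normal_distribution))"
    by (rule measurable_cong_sets) simp_all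
  finally show ?thesis .
qed

text \<open>Independence makes the characteristic function a product of Gaussian factors whose
  exponents add. Working with characteristic functions allows vanishing coefficients and the empty
  sum.\<close>

lemma distr_sum_std_normal:
  fixes b :: "'e \<Rightarrow> real"
  assumes fin: "finite I"
  shows "distr (PiM I (\<lambda>_. std_normal_distribution)) borel (\<lambda>z. \<Sum>e\<in>I. b e * z e)
       = normal_law 0 (\<Sum>e\<in>I. (b e)\<^sup>2)"
proof (rule Levy_uniqueness)
  let ?\<Pi> = "PiM I (\<lambda>_::'e. std_normal_distribution)"
  interpret N: prob_space std_normal_distribution by (rule std_normal_prob_space)
  interpret product_prob_space "\<lambda>_::'e. std_normal_distribution" I by unfold_locales
  have v: "0 \<le> (\<Sum>e\<in>I. (b e)\<^sup>2)" by (simp add: sum_nonneg)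
  have meas: "(\<lambda>z. \<Sum>e\<in>I. b e * z e) \<in> borel_measurable ?\<Pi>"
  proof (intro borel_measurable_sum borel_measurable_times)
    fix e assume "e \<in> I"
    then show "(\<lambda>z. z e) \<in> borel_measurable ?\<Pi>" by (rule std_normal_component_measurable)
  qed simp
  show "real_distribution (distr ?\<Pi> borel (\<lambda>z. \<Sum>e\<in>I. b e * z e))"
    using meas by (rule real_distribution_distr)
  show "real_distribution (normal_law 0 (\<Sum>e\<in>I. (b e)\<^sup>2))"
    unfolding normal_law_eq_distr[OF v] by (rule N.real_distribution_distr) simp
  show "char (distr ?\<Pi> borel (\<lambda>z. \<Sum>e\<in>I. b e * z e)) = char (normal_law 0 (\<Sum>e\<in>I. (b e)\<^sup>2))"
  proof
    fix t
    have "char (distr ?\<Pi> borel (\<lambda>z. \<Sum>e\<in>I. b e * z e)) t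
        = (LINT z|?\<Pi>. iexp (t * (\<Sum>e\<in>I. b e * z e)))"
      unfolding char_def by (rule integral_distr[OF meas]) simp
    also have "\<dots> = (LINT z|?\<Pi>. (\<Prod>e\<in>I. iexp (t * b e * z e)))"
      by (simp only: sum_distrib_left of_real_sum exp_sum[OF fin] mult.assoc)
    also have "\<dots> = (\<Prod>e\<in>I. char std_normal_distribution (t * b e))"
      unfolding char_def
      by (subst product_integral_prod[OF fin])
        (auto intro!: N.integrable_const_bound[of _ 1] simp: norm_exp_i_times)
    also have "\<dots> = (\<Prod>e\<in>I. of_real (exp (- ((b e)\<^sup>2 * t\<^sup>2) / 2)))"
      by (simp add: char_std_normal_distribution power_mult_distrib mult.commute[of "t\<^sup>2"])
    also have "\<dots> = of_real (exp (\<Sum>e\<in>I. - ((b e)\<^sup>2 * t\<^sup>2) / 2))"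
      by (simp only: exp_sum[OF fin] of_real_prod)
    also have "\<dots> = char (normal_law 0 (\<Sum>e\<in>I. (b e)\<^sup>2)) t"
      by (simp only: char_normal_law[OF v] sum_distrib_right sum_divide_distrib flip: sum_negf)
    finally show "char (distr ?\<Pi> borel (\<lambda>z. \<Sum>e\<in>I. b e * z e)) t
        = char (normal_law 0 (\<Sum>e\<in>I. (b e)\<^sup>2)) t" .
  qed
qed

text \<open>With independent standard normals indexed by \<open>I\<close>, the vector with
  coordinates \<open>\<Sum>e\<in>I. A i e * z e\<close> has covariance A A^T. Having the factor
  \<open>A\<close> at hand avoids taking a square root of the covariance matrix.\<close>

lemma ex_multivariate_normal:
  fixes A :: "nat \<Rightarrow> 'e \<Rightarrow> real"
  assumes fin: "finite I"
  defines "S \<equiv> \<lambda>i j. \<Sum>e\<in>I. A i e * A j e"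
  shows "\<exists>N. multivariate_normal g (\<lambda>_. 0) S N \<and>
    (\<forall>a. distr N borel (\<lambda>z. pairing g a z) = normal_law 0 (\<Sum>e\<in>I. (\<Sum>i<g. a i * A i e)\<^sup>2))"
proof -
  let ?\<Pi> = "PiM I (\<lambda>_::'e. std_normal_distribution)"
  interpret N: prob_space std_normal_distribution by (rule std_normal_prob_space)
  interpret product_prob_space "\<lambda>_::'e. std_normal_distribution" I by unfold_locales
  define T where "T z = (\<lambda>i\<in>{..<g}. \<Sum>e\<in>I. A i e * z e)" for z
  have T: "T \<in> measurable ?\<Pi> (vec_borel g)"
    unfolding T_def
  proof (intro measurable_restrict borel_measurable_sum borel_measurable_times)
    fix e assume "e \<in> I"
    then show "(\<lambda>z. z e) \<in> borel_measurable ?\<Pi>" by (rule std_normal_component_measurable)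
  qed simp
  have pairing_meas: "(\<lambda>z. pairing g a z) \<in> borel_measurable (vec_borel g)" for a
    by (intro borel_measurable_sum borel_measurable_times measurable_component_singleton) auto
  define N where "N = distr ?\<Pi> (vec_borel g) T"
  define V where "V a = (\<Sum>e\<in>I. (\<Sum>i<g. a i * A i e)\<^sup>2)" for a
  have V0: "0 \<le> V a" for a by (simp add: V_def sum_nonneg)
  have law: "distr N borel (\<lambda>z. pairing g a z) = normal_law 0 (V a)" for a
  proof -
    have eq: "pairing g a (T z) = (\<Sum>e\<in>I. (\<Sum>i<g. a i * A i e) * z e)" for z
    proof -
      have "pairing g a (T z) = (\<Sum>i<g. \<Sum>e\<in>I. a i * A i e * z e)"
        by (simp add: T_def sum_distrib_left mult.assoc)
      then show ?thesis by (subst (asm) sum.swap) (simp add: sum_distrib_right)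
    qed
    have "distr N borel (\<lambda>z. pairing g a z) = distr ?\<Pi> borel (\<lambda>z. \<Sum>e\<in>I. (\<Sum>i<g. a i * A i e) * z e)"
      unfolding N_def by (subst distr_distr[OF pairing_meas T]) (simp add: comp_def eq)
    then show ?thesis by (simp add: distr_sum_std_normal[OF fin] V_def)
  qed
  have meas_N: "(\<lambda>z. pairing g a z) \<in> borel_measurable N" for a
    using pairing_meas by (simp add: N_def)
  have moments: "(LINT z|N. pairing g a z) = 0" "integrable N (\<lambda>z. (pairing g a z)\<^sup>2)"
    "(LINT z|N. (pairing g a z)\<^sup>2) = V a" for a
  proof -
    have "(LINT x|distr N borel (\<lambda>z. pairing g a z). x) = (LINT z|N. pairing g a z)"
      "(LINT x|distr N borel (\<lambda>z. pairing g a z). x\<^sup>2) = (LINT z|N. (pairing g a z)\<^sup>2)"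
      by (subst integral_distr[OF meas_N]; simp)+
    moreover have "integrable N (\<lambda>z. (pairing g a z)\<^sup>2) \<longleftrightarrow>
        integrable (distr N borel (\<lambda>z. pairing g a z)) (\<lambda>x. x\<^sup>2)"
      by (subst integrable_distr_eq[OF meas_N]) simp_all
    ultimately show "(LINT z|N. pairing g a z) = 0" "integrable N (\<lambda>z. (pairing g a z)\<^sup>2)"
      "(LINT z|N. (pairing g a z)\<^sup>2) = V a"
      using normal_law_moments[OF V0, of a] by (simp_all add: law)
  qed
  define \<delta> where "\<delta> i k = (if k = i then 1 else 0::real)" for i k :: nat
  have \<delta>: "pairing g (\<delta> i) z = z i" "pairing g (\<lambda>k. \<delta> i k + \<delta> j k) z = z i + z j"
    if "i < g" "j < g" for i j and z :: "nat \<Rightarrow> real"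
    using that by (simp_all add: \<delta>_def distrib_right sum.distrib
        if_distrib[where f = "\<lambda>c. c * _"] sum.delta cong: if_cong)
  have mean: "(LINT z|N. z i) = 0" if "i < g" for i
    using moments(1)[of "\<delta> i"] that by (simp add: \<delta>)
  \<comment> \<open>Only the laws of single linear forms are known, so the mixed moment comes by
    polarization from the forms \<open>\<delta> i\<close>, \<open>\<delta> j\<close> and their
    sum.\<close>
  have cov: "(LINT z|N. z i * z j) = S i j" if ij: "i < g" "j < g" for i j
  proof -
    have sq: "integrable N (\<lambda>z. (z i)\<^sup>2)" "integrable N (\<lambda>z. (z j)\<^sup>2)"
      "integrable N (\<lambda>z. (z i + z j)\<^sup>2)"
      using moments(2)[of "\<delta> i"] moments(2)[of "\<delta> j"] moments(2)[of "\<lambda>k. \<delta> i k + \<delta> j k"] ij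
      by (simp_all add: \<delta>)
    have "(LINT z|N. z i * z j) = (LINT z|N. ((z i + z j)\<^sup>2 - (z i)\<^sup>2 - (z j)\<^sup>2) / 2)"
      by (intro Bochner_Integration.integral_cong refl) (simp add: power2_eq_square algebra_simps)
    also have "\<dots> = (V (\<lambda>k. \<delta> i k + \<delta> j k) - V (\<delta> i) - V (\<delta> j)) / 2"
      using sq moments(3)[of "\<delta> i"] moments(3)[of "\<delta> j"] moments(3)[of "\<lambda>k. \<delta> i k + \<delta> j k"] ij
      by (simp add: \<delta>)
    also have "\<dots> = S i j"
      using ij by (simp add: V_def S_def \<delta> power2_sum sum.distrib mult.assoc sum_distrib_left[symmetric])
    finally show ?thesis .
  qed
  have "prob_space N" unfolding N_def by (rule prob_space_distr[OF T])
  then have "multivariate_normal g (\<lambda>_. 0) S N"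
    unfolding multivariate_normal_def using law V0 mean cov by (auto simp: N_def)
  then show ?thesis using law V_def by auto
qed

section \<open>Accumulated homology\<close>

lemma accumulated_homology_sum:
  "of_int (accumulated_homology x y r t i)
   = (\<Sum>j<t. of_bool (r j = x i \<and> r (Suc j) = y i) - of_bool (r j = y i \<and> r (Suc j) = x i) :: real)"
  by (simp add: accumulated_homology_def sum_subtractf sum.If_cases Int_def conj_ac flip: of_bool_conj)

context finite_markov_chain
begin

text \<open>Cramer-Wold argument: a linear combination of coordinates is again an additive
  functional, corrected by the same combination of the \<open>h i\<close>. The one-dimensional
  result gives its characteristic function, which is that of the corresponding form of the Gaussian
  vector.\<close>

lemma reversible_homology_clt:
  fixes x y :: "nat \<Rightarrow> 'a"
  assumes irr: "irreducible_chain V P" and st: "stationary_distribution V P p"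
    and rev: "reversible_chain V P p"
    and xy: "\<And>i. i < g \<Longrightarrow> x i \<in> V" "\<And>i. i < g \<Longrightarrow> y i \<in> V"
  shows "\<exists>S N. multivariate_normal g (\<lambda>_. 0) S N \<and>
    weakly_converges (vec_topology g)
      (\<lambda>t. distr M (vec_borel g)
         (\<lambda>w. \<lambda>i\<in>{..<g}. of_int (accumulated_homology x y (\<lambda>j. X j w) t i) / sqrt (real t)))
      N"
proof -
  define f :: "nat \<Rightarrow> 'a \<Rightarrow> 'a \<Rightarrow> real" where
    "f i u v = of_bool (u = x i \<and> v = y i) - of_bool (u = y i \<and> v = x i)" for i u v
  have p0: "\<And>u. u \<in> V \<Longrightarrow> 0 \<le> p u" and p1: "(\<Sum>u\<in>V. p u) = 1"
    and pP: "\<And>v. v \<in> V \<Longrightarrow> (\<Sum>u\<in>V. p u * P u v) = p v"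
    using st by (auto simp: stationary_distribution_def)
  have pair_sum: "(\<Sum>u\<in>V. \<Sum>v\<in>V. p u * P u v * of_bool (u = a \<and> v = b)) = p a * P a b"
    if "a \<in> V" "b \<in> V" for a b
  proof -
    have "(\<Sum>u\<in>V. \<Sum>v\<in>V. p u * P u v * of_bool (u = a \<and> v = b))
        = (\<Sum>u\<in>V. if u = a then \<Sum>v\<in>V. if v = b then p u * P u v else 0 else 0)"
      by (intro sum.cong refl) (auto simp: of_bool_def intro!: sum.cong sum.neutral)
    then show ?thesis using that finite_states by (simp add: sum.delta)
  qed
  have "\<exists>h. \<forall>u\<in>V. h u - (\<Sum>v\<in>V. P u v * h v) = (\<Sum>v\<in>V. P u v * f i u v)" if i: "i < g" for i
  proof (rule poisson_equation[OF finite_states transition irr st])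
    have "(\<Sum>u\<in>V. p u * (\<Sum>v\<in>V. P u v * f i u v))
        = (\<Sum>u\<in>V. \<Sum>v\<in>V. p u * P u v * of_bool (u = x i \<and> v = y i))
          - (\<Sum>u\<in>V. \<Sum>v\<in>V. p u * P u v * of_bool (u = y i \<and> v = x i))"
      by (simp only: f_def sum_distrib_left right_diff_distrib sum_subtractf mult.assoc)
    also have "\<dots> = 0"
      using rev xy[OF i] by (simp only: pair_sum) (simp add: reversible_chain_def)
    finally show "(\<Sum>u\<in>V. p u * (\<Sum>v\<in>V. P u v * f i u v)) = 0" .
  qed
  then obtain h where h: "\<And>i u. i < g \<Longrightarrow> u \<in> V \<Longrightarrow>
      h i u - (\<Sum>v\<in>V. P u v * h i v) = (\<Sum>v\<in>V. P u v * f i u v)"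
    by metis
  define m where "m i u v = f i u v + h i v - h i u" for i u v
  have m_centred: "(\<Sum>v\<in>V. P u v * m i u v) = 0" if "i < g" "u \<in> V" for i u
  proof -
    have "(\<Sum>v\<in>V. P u v * m i u v)
        = (\<Sum>v\<in>V. P u v * f i u v) + (\<Sum>v\<in>V. P u v * h i v) - (\<Sum>v\<in>V. P u v) * h i u"
      by (simp add: m_def distrib_left right_diff_distrib sum.distrib sum_subtractf sum_distrib_right)
    then show ?thesis using h[OF that] P_sum[OF that(2)] by simp
  qed
  \<comment> \<open>A factor of the covariance indexed by ordered pairs of states: the root of the
    stationary flow along a pair puts the weight \<open>p u * P u v\<close> on each product of two
    increments.\<close>
  define A where "A i e = sqrt (p (fst e) * P (fst e) (snd e)) * m i (fst e) (snd e)" for i e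
  define c where "c a = (\<Sum>e\<in>V \<times> V. (\<Sum>i<g. a i * A i e)\<^sup>2)" for a
  obtain N where N: "multivariate_normal g (\<lambda>_. 0) (\<lambda>i j. \<Sum>e\<in>V \<times> V. A i e * A j e) N"
    and N_law: "\<And>a. distr N borel (\<lambda>z. pairing g a z) = normal_law 0 (c a)"
    using ex_multivariate_normal[of "V \<times> V" g A] finite_states unfolding c_def by blast
  have c0: "0 \<le> c a" for a by (simp add: c_def sum_nonneg)
  define H where "H t w = (\<lambda>i\<in>{..<g}. additive_functional (f i) t (\<lambda>j. X j w) / sqrt (real t))" for t w
  have H: "(\<lambda>i\<in>{..<g}. of_int (accumulated_homology x y (\<lambda>j. X j w) t i) / sqrt (real t)) = H t w" for t w
    by (simp add: H_def accumulated_homology_sum additive_functional_def f_def)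
  have int_af: "integrable M (\<lambda>w. F (additive_functional k t (\<lambda>j. X j w)))"
    for F :: "real \<Rightarrow> real" and k t
    by (rule integrable_path_functional[OF determined_by_additive_functional[of t "\<lambda>s v. F s" k]])
  have H_meas: "H t \<in> measurable M (vec_borel g)" for t
    unfolding H_def[abs_def]
    by (intro measurable_restrict borel_measurable_integrable int_af[of "\<lambda>s. s / sqrt (real t)"])
  have pairing_meas: "(\<lambda>z. pairing g a z) \<in> borel_measurable (vec_borel g)" for a
    by (intro borel_measurable_sum borel_measurable_times measurable_component_singleton) auto
  have coord_meas: "(\<lambda>z. z i) \<in> borel_measurable (vec_borel g)" if "i < g" for i
    using that by (intro measurable_component_singleton) simp
  have sq_meas: "(\<lambda>z. \<Sum>i<g. (z i)\<^sup>2) \<in> borel_measurable (vec_borel g)"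
    by (intro borel_measurable_sum borel_measurable_power coord_meas) simp
  have pairing_H: "pairing g a (H t w)
      = additive_functional (\<lambda>u v. \<Sum>i<g. a i * f i u v) t (\<lambda>j. X j w) / sqrt (real t)" for a t w
  proof -
    have "pairing g a (H t w) = (\<Sum>i<g. \<Sum>j<t. a i * f i (X j w) (X (Suc j) w)) / sqrt (real t)"
      by (simp add: H_def additive_functional_def sum_distrib_left sum_divide_distrib)
    then show ?thesis by (subst (asm) sum.swap) (simp add: additive_functional_def)
  qed

  have clt: "(\<lambda>t. LINT w|M. iexp (pairing g a (H t w))) \<longlonglongrightarrow> of_real (exp (- c a / 2))" for a
  proof -
    define fa ha where "fa u v = (\<Sum>i<g. a i * f i u v)" and "ha u = (\<Sum>i<g. a i * h i u)" for u v
    have ma: "fa u v + ha v - ha u = (\<Sum>i<g. a i * m i u v)" for u v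
      by (simp add: fa_def ha_def m_def distrib_left right_diff_distrib sum.distrib sum_subtractf)
    have centred: "(\<Sum>v\<in>V. P u v * (fa u v + ha v - ha u)) = 0" if "u \<in> V" for u
    proof -
      have "(\<Sum>v\<in>V. P u v * (fa u v + ha v - ha u)) = (\<Sum>i<g. a i * (\<Sum>v\<in>V. P u v * m i u v))"
        by (simp only: ma sum_distrib_left mult.left_commute) (rule sum.swap)
      then show ?thesis using m_centred[OF _ that] by simp
    qed
    define s where "s u = (\<Sum>v\<in>V. P u v * (fa u v + ha v - ha u)\<^sup>2)" for u
    \<comment> \<open>The variance of the Gaussian form is the stationary mean of the conditional
      variance \<open>s\<close>. This is exactly the solvability condition of the second Poisson
      equation.\<close>
    have c_eq: "c a = (\<Sum>u\<in>V. p u * s u)"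
    proof -
      have "c a = (\<Sum>(u, v)\<in>V \<times> V. p u * P u v * (\<Sum>i<g. a i * m i u v)\<^sup>2)"
        unfolding c_def
      proof (intro sum.cong refl, clarify)
        fix u v assume uv: "u \<in> V" "v \<in> V"
        have "(\<Sum>i<g. a i * A i (u, v)) = sqrt (p u * P u v) * (\<Sum>i<g. a i * m i u v)"
          by (simp add: A_def sum_distrib_left mult.left_commute)
        then show "(\<Sum>i<g. a i * A i (u, v))\<^sup>2 = p u * P u v * (\<Sum>i<g. a i * m i u v)\<^sup>2"
          using p0[OF uv(1)] P_nonneg[OF uv] by (simp add: power_mult_distrib)
      qed
      then show ?thesis
        by (simp add: s_def ma sum_distrib_left mult.assoc sum.cartesian_product)
    qed
    have "\<exists>z. \<forall>u\<in>V. z u - (\<Sum>v\<in>V. P u v * z v) = s u - c a"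
    proof (rule poisson_equation[OF finite_states transition irr st])
      show "(\<Sum>u\<in>V. p u * (s u - c a)) = 0"
        using p1 by (simp add: right_diff_distrib sum_subtractf c_eq flip: sum_distrib_right)
    qed
    then obtain z where z: "\<And>u. u \<in> V \<Longrightarrow> z u - (\<Sum>v\<in>V. P u v * z v) = s u - c a" by blast
    have "(\<lambda>t. LINT w|M. iexp (additive_functional fa t (\<lambda>j. X j w) / sqrt (real t)))
        \<longlonglongrightarrow> of_real (exp (- c a / 2))"
    proof (rule additive_functional_clt[OF centred _ c0])
      show "(\<Sum>v\<in>V. P u v * (fa u v + ha v - ha u)\<^sup>2) + (\<Sum>v\<in>V. P u v * z v) = c a + z u"
        if "u \<in> V" for u using z[OF that] by (simp add: s_def)
    qed
    then show ?thesis by (simp add: pairing_H fa_def[abs_def])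
  qed

  have N_prob: "prob_space N" and N_sets: "sets N = sets (vec_borel g)"
    using N by (auto simp: multivariate_normal_def)
  interpret N: prob_space N by fact
  have N_meas: "F \<in> borel_measurable N" if "F \<in> borel_measurable (vec_borel g)" for F :: "_ \<Rightarrow> real"
    using that by (simp cong: measurable_cong_sets[OF N_sets refl])
  have N_char: "(LINT z|N. iexp (pairing g a z)) = of_real (exp (- c a / 2))" for a
  proof -
    have "(LINT z|N. iexp (pairing g a z)) = char (distr N borel (\<lambda>z. pairing g a z)) 1"
      by (simp add: char_def integral_distr[OF N_meas[OF pairing_meas]])
    then show ?thesis using char_normal_law[OF c0, of a 1] by (simp add: N_law)
  qed
  \<comment> \<open>Shifted cosines become real parts of multiples of \<open>iexp\<close>, so
    convergence of the complex integrals yields the cosine hypothesis for every phase.\<close>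
  have cos_eq: "cos (s + b) = Re (iexp b * iexp s)" for s b :: real
    by (simp add: cis_conv_exp[symmetric] cis_mult add.commute)

  have "weakly_converges (vec_topology g) (\<lambda>t. distr M (vec_borel g) (H t)) N"
  proof -
    have "\<exists>C. \<forall>t. (LINT w|M. (additive_functional (f i) t (\<lambda>j. X j w) / sqrt (real t))\<^sup>2) \<le> C"
      if "i < g" for i
      using m_centred[OF that]
      by (intro additive_functional_second_moment[where h = "h i"]) (simp add: m_def)
    then obtain C where C: "\<And>i t. i < g \<Longrightarrow>
        (LINT w|M. (additive_functional (f i) t (\<lambda>j. X j w) / sqrt (real t))\<^sup>2) \<le> C i"
      by metis
    define D where "D = max (\<Sum>i<g. C i) (LINT z|N. (\<Sum>i<g. (z i)\<^sup>2))"
    have sq_H: "(\<Sum>i<g. (H t w i)\<^sup>2)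
        = (\<Sum>i<g. (additive_functional (f i) t (\<lambda>j. X j w) / sqrt (real t))\<^sup>2)" for t w
      by (simp add: H_def)
    note int_sq = int_af[of "\<lambda>s. (s / sqrt (real t))\<^sup>2" for t]
    show ?thesis
    proof (rule weakly_converges_vecI[where D = D])
      show "prob_space (distr M (vec_borel g) (H t))" for t by (rule prob_space_distr[OF H_meas])
      show "(\<lambda>t. LINT z|distr M (vec_borel g) (H t). cos (pairing g a z + b))
          \<longlonglongrightarrow> (LINT z|N. cos (pairing g a z + b))" for a b
      proof -
        have int_M: "integrable M (\<lambda>w. iexp (pairing g a (H t w)))" for t
          by (rule integrable_iexp[OF measurable_compose[OF measurable_compose[OF H_meas pairing_meas]
                borel_measurable_of_real]]) (rule Im_complex_of_real)
        have int_N: "integrable N (\<lambda>z. iexp (pairing g a z))"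
          by (rule N.integrable_iexp[OF measurable_compose[OF N_meas[OF pairing_meas]
                borel_measurable_of_real]]) (rule Im_complex_of_real)
        have "(LINT z|distr M (vec_borel g) (H t). cos (pairing g a z + b))
            = Re (iexp b * (LINT w|M. iexp (pairing g a (H t w))))" for t
        proof -
          have "(LINT z|distr M (vec_borel g) (H t). cos (pairing g a z + b))
              = (LINT w|M. cos (pairing g a (H t w) + b))"
            using pairing_meas by (intro integral_distr[OF H_meas]) measurable
          also have "\<dots> = Re (LINT w|M. iexp b * iexp (pairing g a (H t w)))"
            unfolding cos_eq by (rule integral_Re) (rule integrable_mult_right, rule int_M)
          finally show ?thesis by (simp only: integral_mult_right_zero)
        qed
        moreover have "(LINT z|N. cos (pairing g a z + b)) = Re (iexp b * of_real (exp (- c a / 2)))"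
        proof -
          have "(LINT z|N. cos (pairing g a z + b)) = Re (LINT z|N. iexp b * iexp (pairing g a z))"
            unfolding cos_eq by (rule integral_Re) (rule integrable_mult_right, rule int_N)
          then show ?thesis by (simp only: integral_mult_right_zero N_char)
        qed
        moreover have "(\<lambda>t. Re (iexp b * (LINT w|M. iexp (pairing g a (H t w)))))
            \<longlonglongrightarrow> Re (iexp b * of_real (exp (- c a / 2)))"
          by (intro tendsto_Re tendsto_mult_left clt)
        ultimately show ?thesis by (simp only:)
      qed
      show "integrable (distr M (vec_borel g) (H t)) (\<lambda>z. \<Sum>i<g. (z i)\<^sup>2)" for t
        by (subst integrable_distr_eq[OF H_meas sq_meas])
          (simp only: sq_H, intro Bochner_Integration.integrable_sum int_sq)
      show "(LINT z|distr M (vec_borel g) (H t). (\<Sum>i<g. (z i)\<^sup>2)) \<le> D" for t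
      proof -
        have "(LINT z|distr M (vec_borel g) (H t). (\<Sum>i<g. (z i)\<^sup>2))
            = (\<Sum>i<g. LINT w|M. (additive_functional (f i) t (\<lambda>j. X j w) / sqrt (real t))\<^sup>2)"
          unfolding integral_distr[OF H_meas sq_meas] sq_H
          by (intro Bochner_Integration.integral_sum int_sq)
        also have "\<dots> \<le> (\<Sum>i<g. C i)" using C by (intro sum_mono) simp
        finally show ?thesis by (simp add: D_def)
      qed
      show "integrable N (\<lambda>z. \<Sum>i<g. (z i)\<^sup>2)"
      proof (intro Bochner_Integration.integrable_sum)
        fix i assume i: "i \<in> {..<g}"
        define \<delta> where "\<delta> k = (if k = i then 1 else 0::real)" for k
        have \<delta>: "pairing g \<delta> z = z i" for z
          using i by (simp add: \<delta>_def if_distrib[where f = "\<lambda>c. c * _"] sum.delta cong: if_cong)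
        have "integrable (distr N borel (\<lambda>z. pairing g \<delta> z)) (\<lambda>s. s\<^sup>2)"
          using normal_law_moments(3)[OF c0] by (simp add: N_law)
        then have "integrable N (\<lambda>z. (pairing g \<delta> z)\<^sup>2)"
          by (subst (asm) integrable_distr_eq[OF N_meas[OF pairing_meas]]) simp_all
        then show "integrable N (\<lambda>z. (z i)\<^sup>2)" by (simp only: \<delta>)
      qed
    qed (use N_prob N_sets in \<open>simp_all add: D_def\<close>)
  qed
  then show ?thesis using N unfolding H by blast
qed

end

theorem mainTheorem4:
  fixes G T :: "'a pair_pre_digraph"
    and P :: "'a \<Rightarrow> 'a \<Rightarrow> real" and p :: "'a \<Rightarrow> real"
    and M :: "'w measure" and X :: "nat \<Rightarrow> 'w \<Rightarrow> 'a"
    and g :: nat and x y :: "nat \<Rightarrow> 'a"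
  assumes "pair_graph G"
    and "Digraph_Component.connected (with_proj G)"
    and "transition_matrix (pverts G) P"
    and "\<And>u v. u \<in> pverts G \<Longrightarrow> v \<in> pverts G \<Longrightarrow> u \<noteq> v \<Longrightarrow> {u, v} \<notin> edges G \<Longrightarrow> P u v = 0"
    and "irreducible_chain (pverts G) P"
    and "aperiodic_chain (pverts G) P"
    and "lazy_chain (pverts G) P"
    and "stationary_distribution (pverts G) P p"
    and "reversible_chain (pverts G) P p"
    and "markov_chain M (pverts G) P X"
    and "undirected_spanning_tree T G"
    and "bij_betw (\<lambda>i. {x i, y i}) {..<g} (edges G - edges T)"
  shows "\<exists>S :: nat \<Rightarrow> nat \<Rightarrow> real. \<exists>N. multivariate_normal g (\<lambda>_. 0) S N \<and>
    weakly_converges (vec_topology g)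
      (\<lambda>t. distr M (vec_borel g)
         (\<lambda>w. \<lambda>i\<in>{..<g}. of_int (accumulated_homology x y (\<lambda>j. X j w) t i) / sqrt (real t)))
      N"
proof -
  interpret pair_graph G by fact
  interpret finite_markov_chain M "pverts G" P X
    using assms by unfold_locales auto
  \<comment> \<open>The enumeration speaks of unordered edges and leaves the orientation to
    \<open>x\<close> and \<open>y\<close>. Membership of both ends in the vertex set is read off
    from an underlying arc, in whichever order it matches.\<close>
  have ends: "x i \<in> pverts G" "y i \<in> pverts G" if "i < g" for i
  proof -
    have "{x i, y i} \<in> edges G" using assms(12) that by (auto simp: bij_betw_def)
    then obtain u v where "(u, v) \<in> parcs G" "{x i, y i} = {u, v}" by (auto simp: edges_def)
    then have "{x i, y i} \<subseteq> pverts G" using arc_fst_in_verts arc_snd_in_verts by fastforce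
    then show "x i \<in> pverts G" "y i \<in> pverts G" by auto
  qed
  show ?thesis
    by (rule reversible_homology_clt[OF assms(5,8,9) ends])
qed

end
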